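(* Let $G$ be a finite group and let $\mathscr{C}$ be any set of subgroups of $G$ closed under conjugation. Then the $G$-category $E\mathcal{O}_{\mathscr{C}}$ has series Lefschetz invariant $$\Lambda_{\Sigma}(E\mathcal{O}_{\mathscr{C}})=\sum_{H\in\mathscr{C}}\frac{-\mu_{\mathscr{C}_{+}}(H,\infty)}{|G:H|}\,[G/H]\ \in\ \Omega(G),$$ where $\mathscr{C}_{+}$ is the poset obtained from $\mathscr{C}$ (ordered by inclusion) by adding a unique maximum element $\infty$, and $\mu_{\mathscr{C}_{+}}$ is its Möbius function.
   Context: $\Omega(G)=\mathbb{Q}\otimes_{\mathbb{Z}}\Omega_{\mathbb{Z}}(G)$ is the rational Burnside ring of $G$; $[X]$ denotes the class of a finite $G$-set $X$. Series Lefschetz invariant: let $\mathsf{D}$ be a finite category (finitely many objects and morphisms) with a $G$-action. For $n\ge 0$ let $\mathsf{D}_n$ be the finite $G$-set of non-degenerate $n$-simplices of the nerve of $\mathsf{D}$, i.e. of chains of $n$ composable non-identity morphisms ($\mathsf{D}_0=\mathrm{Obj}(\mathsf{D})$). Put $f_{\mathsf{D}}(t)=\sum_{n\ge0}[\mathsf{D}_n]t^n\in\Omega(G)[[t]]\cong\Omega(G)\otimes_{\mathbb{Q}}\mathbb{Q}[[t]]$. Let $\mathbb{Q}[t]_{(t+1)}$ be the ring of rational functions $p/q$ with $(t+1)\nmid q$. $\mathsf{D}$ has series Lefschetz invariant if $f_{\mathsf{D}}\in\Omega(G)\otimes_{\mathbb{Q}}\mathbb{Q}[t]_{(t+1)}$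 (power series and rational functions being compared inside Laurent series), and then $\Lambda_{\Sigma}(\mathsf{D}):=f_{\mathsf{D}}(-1)\in\Omega(G)$. The orbit category $\mathcal{O}_{\mathscr{C}}$ has object set $\mathscr{C}$, and the morphisms from $H$ to $K$ are the $G$-maps $G/H\to G/K$. The $G$-category $E\mathcal{O}_{\mathscr{C}}$ is the Grothendieck construction of the inclusion functor $\mathcal{O}_{\mathscr{C}}\to G\text{-sets}$, $H\mapsto G/H$: its objects are pairs $(H,a)$ with $H\in\mathscr{C}$, $a\in G/H$; a morphism $(H,a)\to(K,b)$ is a $G$-map $\varphi:G/H\to G/K$ with $\varphi(a)=b$; $G$ acts by $g\cdot(H,a)=(H,ga)$ on objects, and $g$ sends the morphism $(H,a)\to(K,b)$ given by $\varphi$ to the morphism $(H,ga)\to(K,gb)$ given by $\varphi$. *)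

theory Defs
  imports
    "HOL-Algebra.Order"
    "HOL-Algebra.Group_Action"
    "HOL-Algebra.Left_Coset"
    "HOL-Algebra.QuotRing"
    "HOL-Algebra.Module"
    "HOL-Library.Poly_Mapping"
    "HOL-Computational_Algebra.Field_as_Ring"
    "HOL-Computational_Algebra.Polynomial_Factorial"
    "HOL-Computational_Algebra.Polynomial_FPS"
    "HOL-Computational_Algebra.Formal_Laurent_Series"
begin

section \<open>The rational Burnside ring\<close>

definition finite_gset :: "('g, 'b) monoid_scheme \<Rightarrow> 'x set \<Rightarrow> ('g \<Rightarrow> 'x \<Rightarrow> 'x) \<Rightarrow> bool" where
  "finite_gset G X \<phi> \<longleftrightarrow> group_action G X \<phi> \<and> finite X"

definition gset_iso ::
    "('g, 'b) monoid_scheme \<Rightarrow> 'x set \<Rightarrow> ('g \<Rightarrow> 'x \<Rightarrow> 'x) \<Rightarrow> 'y set \<Rightarrow> ('g \<Rightarrow> 'y \<Rightarrow> 'y) \<Rightarrow> bool" where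
  "gset_iso G X \<phi> Y \<psi> \<longleftrightarrow>
     (\<exists>f. bij_betw f X Y \<and> (\<forall>g\<in>carrier G. \<forall>x\<in>X. f (\<phi> g x) = \<psi> g (f x)))"

text \<open>Every finite \<open>G\<close>-set, over whatever type, is isomorphic to one whose points are natural
  numbers, so an isomorphism class is represented by the set of its members of this kind.\<close>

type_synonym 'g gset = "nat set \<times> ('g \<Rightarrow> nat \<Rightarrow> nat)"

definition gset_class ::
    "('g, 'b) monoid_scheme \<Rightarrow> 'x set \<Rightarrow> ('g \<Rightarrow> 'x \<Rightarrow> 'x) \<Rightarrow> 'g gset set" where
  "gset_class G X \<phi> = {(Y, \<psi>). finite_gset G Y \<psi> \<and> gset_iso G X \<phi> Y \<psi>}"

definition gset_classes :: "('g, 'b) monoid_scheme \<Rightarrow> 'g gset set set" where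
  "gset_classes G = {gset_class G X \<phi> | (X :: nat set) \<phi>. finite_gset G X \<phi>}"

definition sum_action ::
    "'x set \<Rightarrow> ('g \<Rightarrow> 'x \<Rightarrow> 'x) \<Rightarrow> 'y set \<Rightarrow> ('g \<Rightarrow> 'y \<Rightarrow> 'y) \<Rightarrow> 'g \<Rightarrow> 'x + 'y \<Rightarrow> 'x + 'y" where
  "sum_action X \<phi> Y \<psi> g = restrict (map_sum (\<phi> g) (\<psi> g)) (Sum_Type.Plus X Y)"

definition prod_action ::
    "'x set \<Rightarrow> ('g \<Rightarrow> 'x \<Rightarrow> 'x) \<Rightarrow> 'y set \<Rightarrow> ('g \<Rightarrow> 'y \<Rightarrow> 'y) \<Rightarrow> 'g \<Rightarrow> 'x \<times> 'y \<Rightarrow> 'x \<times> 'y" where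
  "prod_action X \<phi> Y \<psi> g = restrict (map_prod (\<phi> g) (\<psi> g)) (X \<times> Y)"

definition gset_class_prod ::
    "('g, 'b) monoid_scheme \<Rightarrow> 'g gset set \<Rightarrow> 'g gset set \<Rightarrow> 'g gset set" where
  "gset_class_prod G A B =
     (\<Union>(X, \<phi>)\<in>A. \<Union>(Y, \<psi>)\<in>B. gset_class G (X \<times> Y) (prod_action X \<phi> Y \<psi>))"

text \<open>The Burnside ring is presented by the isomorphism classes of finite \<open>G\<close>-sets as
  generators and \<open>[X \<squnion> Y] = [X] + [Y]\<close> as linear relations, the multiplication being induced by
  the cartesian product. Tensoring with the rationals turns this into the quotient of the rational
  monoid algebra on the isomorphism classes by the rational span of the relations. This span is an
  ideal because the product of a generator with a relation is again a relation.\<close>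

definition gset_algebra :: "('g, 'b) monoid_scheme \<Rightarrow> ('g gset set \<Rightarrow>\<^sub>0 rat) ring" where
  "gset_algebra G =
     \<lparr>carrier = {u. Poly_Mapping.keys u \<subseteq> gset_classes G},
      monoid.mult = (\<lambda>u v. \<Sum>A\<in>Poly_Mapping.keys u. \<Sum>B\<in>Poly_Mapping.keys v.
                Poly_Mapping.single (gset_class_prod G A B) (Poly_Mapping.lookup u A * Poly_Mapping.lookup v B)),
      one = Poly_Mapping.single (gset_class G {()} (\<lambda>g. \<lambda>x\<in>{()}. x)) 1,
      zero = 0,
      add = (+)\<rparr>"

definition burnside_relations :: "('g, 'b) monoid_scheme \<Rightarrow> ('g gset set \<Rightarrow>\<^sub>0 rat) set" where
  "burnside_relations G =
     {Poly_Mapping.single (gset_class G (Sum_Type.Plus X Y) (sum_action X \<phi> Y \<psi>)) 1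
        - Poly_Mapping.single (gset_class G X \<phi>) 1
        - Poly_Mapping.single (gset_class G Y \<psi>) 1
      | (X :: nat set) \<phi> (Y :: nat set) \<psi>. finite_gset G X \<phi> \<and> finite_gset G Y \<psi>}"

definition burnside_ideal :: "('g, 'b) monoid_scheme \<Rightarrow> ('g gset set \<Rightarrow>\<^sub>0 rat) set" where
  "burnside_ideal G =
     {\<Sum>r\<in>S. Poly_Mapping.map ((*) (c r)) r | S (c :: _ \<Rightarrow> rat).
        finite S \<and> S \<subseteq> burnside_relations G}"

definition burnside_ring ::
    "('g, 'b) monoid_scheme \<Rightarrow> (rat, ('g gset set \<Rightarrow>\<^sub>0 rat) set) module" (\<open>\<Omega>\<close>) where
  "\<Omega> G = ring.extend (gset_algebra G Quot burnside_ideal G)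
     \<lparr>module.smult = (\<lambda>c A. \<Union>u\<in>A. burnside_ideal G +>\<^bsub>gset_algebra G\<^esub> Poly_Mapping.map ((*) c) u)\<rparr>"

definition burnside_class ::
    "('g, 'b) monoid_scheme \<Rightarrow> 'x set \<Rightarrow> ('g \<Rightarrow> 'x \<Rightarrow> 'x) \<Rightarrow> ('g gset set \<Rightarrow>\<^sub>0 rat) set" where
  "burnside_class G X \<phi> =
     burnside_ideal G +>\<^bsub>gset_algebra G\<^esub> Poly_Mapping.single (gset_class G X \<phi>) 1"


section \<open>Finite categories with a group action\<close>

record ('o, 'm) category =
  obj :: "'o set"
  mor :: "'m set"
  src :: "'m \<Rightarrow> 'o"
  trg :: "'m \<Rightarrow> 'o"
  ident :: "'o \<Rightarrow> 'm"
  comp :: "'m \<Rightarrow> 'm \<Rightarrow> 'm"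

text \<open>\<open>comp D n m\<close> is the composite of \<open>m\<close> followed by \<open>n\<close>.\<close>

locale finite_category =
  fixes D :: "('o, 'm, 'z) category_scheme"
  assumes finite_obj: "finite (obj D)"
    and finite_mor: "finite (mor D)"
    and src_obj: "m \<in> mor D \<Longrightarrow> src D m \<in> obj D"
    and trg_obj: "m \<in> mor D \<Longrightarrow> trg D m \<in> obj D"
    and ident_mor: "x \<in> obj D \<Longrightarrow> ident D x \<in> mor D"
    and src_ident: "x \<in> obj D \<Longrightarrow> src D (ident D x) = x"
    and trg_ident: "x \<in> obj D \<Longrightarrow> trg D (ident D x) = x"
    and comp_mor: "\<lbrakk>m \<in> mor D; n \<in> mor D; trg D m = src D n\<rbrakk> \<Longrightarrow> comp D n m \<in> mor D"
    and src_comp: "\<lbrakk>m \<in> mor D; n \<in> mor D; trg D m = src D n\<rbrakk> \<Longrightarrow> src D (comp D n m) = src D m"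
    and trg_comp: "\<lbrakk>m \<in> mor D; n \<in> mor D; trg D m = src D n\<rbrakk> \<Longrightarrow> trg D (comp D n m) = trg D n"
    and comp_ident_right: "m \<in> mor D \<Longrightarrow> comp D m (ident D (src D m)) = m"
    and comp_ident_left: "m \<in> mor D \<Longrightarrow> comp D (ident D (trg D m)) m = m"
    and comp_assoc: "\<lbrakk>l \<in> mor D; m \<in> mor D; n \<in> mor D; trg D l = src D m; trg D m = src D n\<rbrakk>
      \<Longrightarrow> comp D n (comp D m l) = comp D (comp D n m) l"

record ('g, 'o, 'm) gcategory = "('o, 'm) category" +
  act_obj :: "'g \<Rightarrow> 'o \<Rightarrow> 'o"
  act_mor :: "'g \<Rightarrow> 'm \<Rightarrow> 'm"

locale finite_gcategory = finite_category D
  for G :: "('g, 'b) monoid_scheme" and D :: "('g, 'o, 'm, 'z) gcategory_scheme" +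
  assumes action_obj: "group_action G (obj D) (act_obj D)"
    and action_mor: "group_action G (mor D) (act_mor D)"
    and act_src: "\<lbrakk>g \<in> carrier G; m \<in> mor D\<rbrakk> \<Longrightarrow> src D (act_mor D g m) = act_obj D g (src D m)"
    and act_trg: "\<lbrakk>g \<in> carrier G; m \<in> mor D\<rbrakk> \<Longrightarrow> trg D (act_mor D g m) = act_obj D g (trg D m)"
    and act_ident: "\<lbrakk>g \<in> carrier G; x \<in> obj D\<rbrakk>
      \<Longrightarrow> act_mor D g (ident D x) = ident D (act_obj D g x)"
    and act_comp: "\<lbrakk>g \<in> carrier G; m \<in> mor D; n \<in> mor D; trg D m = src D n\<rbrakk>
      \<Longrightarrow> act_mor D g (comp D n m) = comp D (act_mor D g n) (act_mor D g m)"

text \<open>A simplex is encoded as its initial vertex together with the list of its morphisms; the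
  vertex is redundant except in dimension 0.\<close>

fun nondegenerate_chain :: "('o, 'm, 'z) category_scheme \<Rightarrow> 'o \<Rightarrow> 'm list \<Rightarrow> bool" where
  "nondegenerate_chain D x [] \<longleftrightarrow> x \<in> obj D"
| "nondegenerate_chain D x (m # ms) \<longleftrightarrow>
     m \<in> mor D \<and> src D m = x \<and> m \<notin> ident D ` obj D \<and> nondegenerate_chain D (trg D m) ms"

definition simplices :: "('o, 'm, 'z) category_scheme \<Rightarrow> nat \<Rightarrow> ('o \<times> 'm list) set" where
  "simplices D n = {(x, ms). length ms = n \<and> nondegenerate_chain D x ms}"

definition simplex_action ::
    "('g, 'o, 'm, 'z) gcategory_scheme \<Rightarrow> nat \<Rightarrow> 'g \<Rightarrow> 'o \<times> 'm list \<Rightarrow> 'o \<times> 'm list" where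
  "simplex_action D n g = restrict (map_prod (act_obj D g) (map (act_mor D g))) (simplices D n)"


section \<open>The series Lefschetz invariant\<close>

definition simplex_series ::
    "('g, 'b) monoid_scheme \<Rightarrow> ('g, 'o, 'm, 'z) gcategory_scheme
      \<Rightarrow> nat \<Rightarrow> ('g gset set \<Rightarrow>\<^sub>0 rat) set" where
  "simplex_series G D n = burnside_class G (simplices D n) (simplex_action D n)"

definition laurent_of_power_series ::
    "('g, 'b) monoid_scheme \<Rightarrow> (nat \<Rightarrow> ('g gset set \<Rightarrow>\<^sub>0 rat) set)
      \<Rightarrow> int \<Rightarrow> ('g gset set \<Rightarrow>\<^sub>0 rat) set" where
  "laurent_of_power_series G f k = (if k < 0 then \<zero>\<^bsub>\<Omega> G\<^esub> else f (nat k))"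

definition rational_functions_at_minus_one :: "rat poly fract set" where
  "rational_functions_at_minus_one = {Fract p q | p q. \<not> [:1, 1:] dvd q}"

definition laurent_of_fract :: "rat poly fract \<Rightarrow> rat fls" where
  "laurent_of_fract r =
     fps_to_fls (fps_of_poly (fst (quot_of_fract r)))
       / fps_to_fls (fps_of_poly (snd (quot_of_fract r)))"

definition fract_at_minus_one :: "rat poly fract \<Rightarrow> rat" where
  "fract_at_minus_one r =
     poly (fst (quot_of_fract r)) (-1) / poly (snd (quot_of_fract r)) (-1)"

lemma laurent_of_fract_Fract:
  assumes "q \<noteq> 0"
  shows "laurent_of_fract (Fract p q) =
    fps_to_fls (fps_of_poly p) / fps_to_fls (fps_of_poly q)"
proof -
  define a b where "a = fst (quot_of_fract (Fract p q))" and "b = snd (quot_of_fract (Fract p q))"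
  have b: "b \<noteq> 0"
    by (simp add: b_def)
  have "Fract a b = Fract p q"
    by (simp add: a_def b_def)
  then have "a * q = p * b"
    using assms b by (simp add: eq_fract)
  then have "fps_to_fls (fps_of_poly a) * fps_to_fls (fps_of_poly q) =
      fps_to_fls (fps_of_poly p) * fps_to_fls (fps_of_poly b)"
    by (simp flip: fls_times_fps_to_fls fps_of_poly_mult)
  moreover have "fps_to_fls (fps_of_poly q) \<noteq> 0" "fps_to_fls (fps_of_poly b) \<noteq> 0"
    using assms b by (auto simp: fps_to_fls_eq_0_iff)
  ultimately show ?thesis
    unfolding laurent_of_fract_def a_def[symmetric] b_def[symmetric]
    by (simp add: frac_eq_eq)
qed

lemma fract_at_minus_one_Fract:
  assumes "\<not> [:1, 1:] dvd q"
  shows "fract_at_minus_one (Fract p q) = poly p (-1) / poly q (-1)"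
proof -
  define a b where "a = fst (quot_of_fract (Fract p q))" and "b = snd (quot_of_fract (Fract p q))"
  have dvd_iff: "[:1, 1:] dvd u \<longleftrightarrow> poly u (-1) = 0" for u :: "rat poly"
    using poly_eq_0_iff_dvd[of u "-1"] by simp
  have q: "poly q (-1) \<noteq> 0" "q \<noteq> 0"
    using assms by (auto simp: dvd_iff)
  have "b \<noteq> 0" "coprime a b"
    by (simp_all add: a_def b_def coprime_quot_of_fract)
  have "Fract a b = Fract p q"
    by (simp add: a_def b_def)
  then have eq: "a * q = p * b"
    using q \<open>b \<noteq> 0\<close> by (simp add: eq_fract)
  then have "b dvd a * q"
    by simp
  then have "b dvd q"
    using \<open>coprime a b\<close> by (metis coprime_commute coprime_dvd_mult_right_iff)
  then have "poly b (-1) \<noteq> 0"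
    using q by (auto elim!: dvdE)
  moreover have "poly a (-1) * poly q (-1) = poly p (-1) * poly b (-1)"
    using eq by (metis poly_mult)
  ultimately show ?thesis
    unfolding fract_at_minus_one_def a_def[symmetric] b_def[symmetric]
    using q by (simp add: frac_eq_eq)
qed

text \<open>The Laurent series \<open>f\<close> with coefficients in \<open>\<Omega> G\<close> is the image of the tensor
  \<open>\<Sum>i<n. x i \<otimes> r i\<close>.\<close>

definition represents ::
    "('g, 'b) monoid_scheme \<Rightarrow> (int \<Rightarrow> ('g gset set \<Rightarrow>\<^sub>0 rat) set) \<Rightarrow> nat
      \<Rightarrow> (nat \<Rightarrow> ('g gset set \<Rightarrow>\<^sub>0 rat) set) \<Rightarrow> (nat \<Rightarrow> rat poly fract) \<Rightarrow> bool" where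
  "represents G f n x r \<longleftrightarrow>
     (\<forall>i<n. x i \<in> carrier (\<Omega> G) \<and> r i \<in> rational_functions_at_minus_one) \<and>
     (\<forall>k. f k = (\<Oplus>\<^bsub>\<Omega> G\<^esub>i\<in>{..<n}. fls_nth (laurent_of_fract (r i)) k \<odot>\<^bsub>\<Omega> G\<^esub> x i))"

text \<open>The description below determines a unique value because the rational functions that are
  regular at \<open>-1\<close> embed into the Laurent series and \<open>\<Omega> G\<close> is a rational vector space, so that a
  Laurent series is the image of at most one tensor.\<close>

definition value_at_minus_one ::
    "('g, 'b) monoid_scheme \<Rightarrow> (int \<Rightarrow> ('g gset set \<Rightarrow>\<^sub>0 rat) set) \<Rightarrow> ('g gset set \<Rightarrow>\<^sub>0 rat) set" where
  "value_at_minus_one G f =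
     (THE v. \<exists>n x r. represents G f n x r \<and>
        v = (\<Oplus>\<^bsub>\<Omega> G\<^esub>i\<in>{..<n}. fract_at_minus_one (r i) \<odot>\<^bsub>\<Omega> G\<^esub> x i))"

definition has_series_lefschetz_invariant ::
    "('g, 'b) monoid_scheme \<Rightarrow> ('g, 'o, 'm, 'z) gcategory_scheme \<Rightarrow> bool" where
  "has_series_lefschetz_invariant G D \<longleftrightarrow>
     (\<exists>n x r. represents G (laurent_of_power_series G (simplex_series G D)) n x r)"

definition series_lefschetz_invariant ::
    "('g, 'b) monoid_scheme \<Rightarrow> ('g, 'o, 'm, 'z) gcategory_scheme \<Rightarrow> ('g gset set \<Rightarrow>\<^sub>0 rat) set"
    (\<open>\<Lambda>\<^sub>\<Sigma>\<close>) where
  "\<Lambda>\<^sub>\<Sigma> G D = value_at_minus_one G (laurent_of_power_series G (simplex_series G D))"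


section \<open>The orbit category and its Grothendieck construction\<close>

definition coset_action :: "('g, 'b) monoid_scheme \<Rightarrow> 'g set \<Rightarrow> 'g \<Rightarrow> 'g set \<Rightarrow> 'g set" where
  "coset_action G H g = (\<lambda>a\<in>lcosets\<^bsub>G\<^esub> H. g <#\<^bsub>G\<^esub> a)"

definition coset_gmaps ::
    "('g, 'b) monoid_scheme \<Rightarrow> 'g set \<Rightarrow> 'g set \<Rightarrow> ('g set \<Rightarrow> 'g set) set" where
  "coset_gmaps G H K =
     {\<phi> \<in> (lcosets\<^bsub>G\<^esub> H) \<rightarrow>\<^sub>E (lcosets\<^bsub>G\<^esub> K).
        \<forall>g\<in>carrier G. \<forall>a\<in>lcosets\<^bsub>G\<^esub> H. \<phi> (coset_action G H g a) = coset_action G K g (\<phi> a)}"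

definition orbit_category ::
    "('g, 'b) monoid_scheme \<Rightarrow> 'g set set
      \<Rightarrow> ('g set, 'g set \<times> ('g set \<Rightarrow> 'g set) \<times> 'g set) category" where
  "orbit_category G \<C> =
     \<lparr>obj = \<C>,
      mor = {(H, \<phi>, K). H \<in> \<C> \<and> K \<in> \<C> \<and> \<phi> \<in> coset_gmaps G H K},
      src = (\<lambda>(H, \<phi>, K). H),
      trg = (\<lambda>(H, \<phi>, K). K),
      ident = (\<lambda>H. (H, (\<lambda>a\<in>lcosets\<^bsub>G\<^esub> H. a), H)),
      comp = (\<lambda>(_, \<psi>, L) (H, \<phi>, _). (H, compose (lcosets\<^bsub>G\<^esub> H) \<psi> \<phi>, L))\<rparr>"

type_synonym 'g pointed_orbit = "'g set \<times> 'g set"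

definition E_orbit_category_obj ::
    "('g, 'b) monoid_scheme \<Rightarrow> 'g set set \<Rightarrow> 'g pointed_orbit set" where
  "E_orbit_category_obj G \<C> = {(H, a). H \<in> obj (orbit_category G \<C>) \<and> a \<in> lcosets\<^bsub>G\<^esub> H}"

definition E_orbit_category_mor ::
    "('g, 'b) monoid_scheme \<Rightarrow> 'g set set
      \<Rightarrow> ('g pointed_orbit \<times> ('g set \<Rightarrow> 'g set) \<times> 'g pointed_orbit) set" where
  "E_orbit_category_mor G \<C> =
     {((H, a), \<phi>, (K, b)). (H, \<phi>, K) \<in> mor (orbit_category G \<C>) \<and> a \<in> lcosets\<^bsub>G\<^esub> H \<and> \<phi> a = b}"

definition E_orbit_category ::
    "('g, 'b) monoid_scheme \<Rightarrow> 'g set set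
      \<Rightarrow> ('g, 'g pointed_orbit,
          'g pointed_orbit \<times> ('g set \<Rightarrow> 'g set) \<times> 'g pointed_orbit) gcategory" where
  "E_orbit_category G \<C> =
     \<lparr>obj = E_orbit_category_obj G \<C>,
      mor = E_orbit_category_mor G \<C>,
      src = (\<lambda>(x, \<phi>, y). x),
      trg = (\<lambda>(x, \<phi>, y). y),
      ident = (\<lambda>(H, a). ((H, a), (\<lambda>c\<in>lcosets\<^bsub>G\<^esub> H. c), (H, a))),
      comp = (\<lambda>(_, \<psi>, z) ((H, a), \<phi>, _). ((H, a), compose (lcosets\<^bsub>G\<^esub> H) \<psi> \<phi>, z)),
      act_obj = (\<lambda>g. \<lambda>(H, a)\<in>E_orbit_category_obj G \<C>. (H, coset_action G H g a)),
      act_mor = (\<lambda>g. \<lambda>((H, a), \<phi>, (K, b))\<in>E_orbit_category_mor G \<C>.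
                   ((H, coset_action G H g a), \<phi>, (K, coset_action G K g b)))\<rparr>"

lemma group_actionI:
  assumes G: "group G"
    and closed: "\<And>g x. \<lbrakk>g \<in> carrier G; x \<in> E\<rbrakk> \<Longrightarrow> \<phi> g x \<in> E"
    and ext: "\<And>g. g \<in> carrier G \<Longrightarrow> \<phi> g \<in> extensional E"
    and one: "\<And>x. x \<in> E \<Longrightarrow> \<phi> \<one>\<^bsub>G\<^esub> x = x"
    and mult: "\<And>g h x. \<lbrakk>g \<in> carrier G; h \<in> carrier G; x \<in> E\<rbrakk>
      \<Longrightarrow> \<phi> (g \<otimes>\<^bsub>G\<^esub> h) x = \<phi> g (\<phi> h x)"
  shows "group_action G E \<phi>"
proof -
  interpret group G by fact
  have inv: "\<phi> (inv\<^bsub>G\<^esub> g) (\<phi> g x) = x" "\<phi> g (\<phi> (inv\<^bsub>G\<^esub> g) x) = x"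
    if "g \<in> carrier G" "x \<in> E" for g x
    using that one mult[of "inv\<^bsub>G\<^esub> g" g x] mult[of g "inv\<^bsub>G\<^esub> g" x] by simp_all
  have Bij: "\<phi> g \<in> Bij E" if "g \<in> carrier G" for g
  proof -
    have "bij_betw (\<phi> g) E E"
      by (rule bij_betw_byWitness[where f' = "\<phi> (inv\<^bsub>G\<^esub> g)"]) (use that inv closed in auto)
    with that ext show ?thesis
      by (simp add: Bij_def)
  qed
  have "\<phi> (g \<otimes>\<^bsub>G\<^esub> h) = compose E (\<phi> g) (\<phi> h)"
    if "g \<in> carrier G" "h \<in> carrier G" for g h
    by (rule extensionalityI[where A = E]) (use that ext mult in \<open>auto simp: compose_def\<close>)
  with Bij have "\<phi> \<in> hom G (BijGroup E)"
    by (auto simp: hom_def BijGroup_def)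
  then show ?thesis
    using G group_BijGroup by (simp add: group_action_def group_hom_def group_hom_axioms_def)
qed

lemma group_action_coset_action:
  assumes "group G" "subgroup H G"
  shows "group_action G (lcosets\<^bsub>G\<^esub> H) (coset_action G H)"
proof -
  interpret group G by fact
  have H: "H \<subseteq> carrier G"
    using assms(2) by (rule subgroup.subset)
  have closed: "g <#\<^bsub>G\<^esub> a \<in> lcosets\<^bsub>G\<^esub> H" if "g \<in> carrier G" "a \<in> lcosets\<^bsub>G\<^esub> H" for g a
    using that H by (auto simp: LCOSETS_def lcos_m_assoc)
  have sub: "a \<subseteq> carrier G" if "a \<in> lcosets\<^bsub>G\<^esub> H" for a
    using that H l_coset_subset_G by (auto simp: LCOSETS_def)
  show ?thesis
    by (rule group_actionI)
      (use assms closed sub in \<open>auto simp: coset_action_def lcos_mult_one lcos_m_assoc\<close>)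
qed

lemma finite_gcategory_E_orbit_category:
  assumes "group G" "finite (carrier G)" "\<And>H. H \<in> \<C> \<Longrightarrow> subgroup H G"
  shows "finite_gcategory G (E_orbit_category G \<C>)"
proof -
  interpret group G by fact
  let ?L = "\<lambda>H. lcosets\<^bsub>G\<^esub> H" and ?D = "E_orbit_category G \<C>"
  have act: "group_action G (?L H) (coset_action G H)" if "H \<in> \<C>" for H
    using assms that by (simp add: group_action_coset_action)
  have closed: "coset_action G H g a \<in> ?L H" if "H \<in> \<C>" "g \<in> carrier G" "a \<in> ?L H" for H g a
    by (rule group_action.element_image[OF act[OF that(1)] that(2,3) refl])
  have one: "coset_action G H \<one>\<^bsub>G\<^esub> a = a" if "H \<in> \<C>" "a \<in> ?L H" for H a
    using group_action.id_eq_one[OF act[OF that(1)]] that(2) by (metis restrict_apply')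
  have mult: "coset_action G H (g \<otimes>\<^bsub>G\<^esub> h) a = coset_action G H g (coset_action G H h a)"
    if "H \<in> \<C>" "g \<in> carrier G" "h \<in> carrier G" "a \<in> ?L H" for H g h a
    by (rule group_action.composition_rule[OF act[OF that(1)] that(4,2,3)])
  have gmapD: "\<phi> a \<in> ?L K" "g \<in> carrier G \<Longrightarrow> \<phi> (coset_action G H g a) = coset_action G K g (\<phi> a)"
    if "\<phi> \<in> coset_gmaps G H K" "a \<in> ?L H" for \<phi> H K g a
    using that by (auto simp: coset_gmaps_def)
  have id: "(\<lambda>a\<in>?L H. a) \<in> coset_gmaps G H H" if "H \<in> \<C>" for H
    using that closed by (auto simp: coset_gmaps_def)
  have comp: "compose (?L H) \<psi> \<phi> \<in> coset_gmaps G H M"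
    if "H \<in> \<C>" "\<phi> \<in> coset_gmaps G H K" "\<psi> \<in> coset_gmaps G K M" for H K M \<phi> \<psi>
  proof -
    note \<phi> = gmapD[OF that(2)] and \<psi> = gmapD[OF that(3)]
    have "compose (?L H) \<psi> \<phi> \<in> ?L H \<rightarrow>\<^sub>E ?L M"
      using \<phi>(1) \<psi>(1) by (auto simp: compose_def)
    moreover have "compose (?L H) \<psi> \<phi> (coset_action G H g a) =
        coset_action G M g (compose (?L H) \<psi> \<phi> a)" if "g \<in> carrier G" "a \<in> ?L H" for g a
      using that closed[OF \<open>H \<in> \<C>\<close>] \<phi> \<psi> by (simp add: compose_eq)
    ultimately show ?thesis
      by (simp add: coset_gmaps_def)
  qed
  have units: "compose (?L H) \<phi> (\<lambda>a\<in>?L H. a) = \<phi>" "compose (?L H) (\<lambda>a\<in>?L K. a) \<phi> = \<phi>"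
    if "\<phi> \<in> coset_gmaps G H K" for \<phi> H K
    using that by (auto simp: coset_gmaps_def PiE_def intro: compose_Id Id_compose)
  have assoc: "compose (?L H) \<chi> (compose (?L H) \<psi> \<phi>) = compose (?L H) (compose (?L K) \<chi> \<psi>) \<phi>"
    if "\<phi> \<in> coset_gmaps G H K" for \<phi> \<psi> \<chi> H K
    using that by (intro compose_assoc) (auto simp: coset_gmaps_def)
  have fin_C: "finite \<C>"
    by (rule finite_subset[of _ "Pow (carrier G)"]) (use assms subgroup.subset in auto)
  have fin_L: "finite (?L H)" for H
    using assms by (simp add: LCOSETS_def)
  have fin_obj: "finite (E_orbit_category_obj G \<C>)"
  proof -
    have "E_orbit_category_obj G \<C> = Sigma \<C> ?L"
      by (auto simp: E_orbit_category_obj_def orbit_category_def)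
    then show ?thesis
      using fin_C fin_L by simp
  qed
  have fin_mor: "finite (E_orbit_category_mor G \<C>)"
  proof (rule finite_subset)
    show "E_orbit_category_mor G \<C> \<subseteq> E_orbit_category_obj G \<C> \<times>
        (\<Union>H\<in>\<C>. \<Union>K\<in>\<C>. ?L H \<rightarrow>\<^sub>E ?L K) \<times> E_orbit_category_obj G \<C>"
      by (fastforce simp: E_orbit_category_obj_def E_orbit_category_mor_def orbit_category_def
          coset_gmaps_def)
    show "finite (E_orbit_category_obj G \<C> \<times>
        (\<Union>H\<in>\<C>. \<Union>K\<in>\<C>. ?L H \<rightarrow>\<^sub>E ?L K) \<times> E_orbit_category_obj G \<C>)"
      using fin_C fin_L fin_obj by (intro finite_cartesian_product finite_UN_I finite_PiE) auto
  qed
  note defs = E_orbit_category_def E_orbit_category_obj_def E_orbit_category_mor_def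
    orbit_category_def
  have mor_act: "act_mor ?D g m \<in> mor ?D" if "g \<in> carrier G" "m \<in> mor ?D" for g m
    using that closed gmapD by (auto simp: defs)
  show ?thesis
  proof (intro finite_gcategory.intro finite_category.intro finite_gcategory_axioms.intro)
    show "finite (obj ?D)" "finite (mor ?D)"
      using fin_obj fin_mor by (simp_all add: E_orbit_category_def)
    show "group_action G (obj ?D) (act_obj ?D)"
      by (rule group_actionI) (use assms(1) closed one mult in \<open>auto simp: defs\<close>)
    show "group_action G (mor ?D) (act_mor ?D)"
    proof (rule group_actionI)
      show "act_mor ?D g \<in> extensional (mor ?D)" for g
        by (simp add: E_orbit_category_def)
    qed (use assms(1) mor_act closed one mult gmapD in \<open>auto simp: defs\<close>)
  next
    fix m assume "m \<in> mor ?D"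
    then show "src ?D m \<in> obj ?D" "trg ?D m \<in> obj ?D"
      "comp ?D m (ident ?D (src ?D m)) = m" "comp ?D (ident ?D (trg ?D m)) m = m"
      using gmapD units by (auto simp: defs)
  next
    fix x assume "x \<in> obj ?D"
    then show "ident ?D x \<in> mor ?D" "src ?D (ident ?D x) = x" "trg ?D (ident ?D x) = x"
      using id by (auto simp: defs)
  next
    fix m n assume "m \<in> mor ?D" "n \<in> mor ?D" "trg ?D m = src ?D n"
    then show "comp ?D n m \<in> mor ?D" "src ?D (comp ?D n m) = src ?D m"
      "trg ?D (comp ?D n m) = trg ?D n"
      using comp by (auto simp: defs compose_eq)
  next
    fix l m n assume "l \<in> mor ?D" "m \<in> mor ?D" "n \<in> mor ?D"
      "trg ?D l = src ?D m" "trg ?D m = src ?D n"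
    then show "comp ?D n (comp ?D m l) = comp ?D (comp ?D n m) l"
      using assoc by (auto simp: defs)
  next
    fix g m assume "g \<in> carrier G" "m \<in> mor ?D"
    then show "src ?D (act_mor ?D g m) = act_obj ?D g (src ?D m)"
      "trg ?D (act_mor ?D g m) = act_obj ?D g (trg ?D m)"
      using gmapD by (auto simp: defs)
  next
    fix g x assume "g \<in> carrier G" "x \<in> obj ?D"
    then show "act_mor ?D g (ident ?D x) = ident ?D (act_obj ?D g x)"
      using id by (auto simp: defs)
  next
    fix g m n assume "g \<in> carrier G" "m \<in> mor ?D" "n \<in> mor ?D" "trg ?D m = src ?D n"
    then show "act_mor ?D g (comp ?D n m) = comp ?D (act_mor ?D g n) (act_mor ?D g m)"
      using comp by (auto simp: defs compose_eq)
  qed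
qed


section \<open>Moebius functions of finite posets\<close>

function moebius :: "('p, 'z) gorder_scheme \<Rightarrow> 'p \<Rightarrow> 'p \<Rightarrow> int" where
  "moebius P x y =
     (if finite (carrier P) \<and> partial_order P \<and> x \<in> carrier P \<and> y \<in> carrier P \<and> x \<sqsubseteq>\<^bsub>P\<^esub> y
      then if x = y then 1
           else - (\<Sum>z\<in>{z \<in> carrier P. x \<sqsubseteq>\<^bsub>P\<^esub> z \<and> z \<sqsubseteq>\<^bsub>P\<^esub> y \<and> z \<noteq> y}. moebius P x z)
      else 0)"
  by pat_completeness auto
termination
proof (relation "measure (\<lambda>(P, x, y). card {z \<in> carrier P. z \<sqsubseteq>\<^bsub>P\<^esub> y})", goal_cases)
  case (2 P x y z)
  then have fin: "finite (carrier P)" and zy: "z \<in> carrier P" "y \<in> carrier P" "z \<sqsubseteq>\<^bsub>P\<^esub> y" "z \<noteq> y"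
    and "partial_order P" by simp_all
  interpret partial_order P by fact
  have "{w \<in> carrier P. w \<sqsubseteq>\<^bsub>P\<^esub> z} \<subseteq> {w \<in> carrier P. w \<sqsubseteq>\<^bsub>P\<^esub> y}"
    using zy le_trans by blast
  moreover have "y \<notin> {w \<in> carrier P. w \<sqsubseteq>\<^bsub>P\<^esub> z}"
    using zy le_antisym by blast
  moreover have "y \<in> {w \<in> carrier P. w \<sqsubseteq>\<^bsub>P\<^esub> y}"
    using zy by simp
  ultimately have "{w \<in> carrier P. w \<sqsubseteq>\<^bsub>P\<^esub> z} \<subset> {w \<in> carrier P. w \<sqsubseteq>\<^bsub>P\<^esub> y}"
    by blast
  with fin show ?case by (simp add: psubset_card_mono)
qed simp

declare moebius.simps [simp del]

definition adjoin_top :: "'p set set \<Rightarrow> 'p set option gorder" where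
  "adjoin_top \<C> =
     \<lparr>carrier = insert None (Some ` \<C>),
      eq = (=),
      le = (\<lambda>x y. case (x, y) of
              (_, None) \<Rightarrow> True
            | (None, Some _) \<Rightarrow> False
            | (Some H, Some K) \<Rightarrow> H \<subseteq> K)\<rparr>"

lemma partial_order_adjoin_top: "partial_order (adjoin_top \<C>)"
  by unfold_locales (auto simp: adjoin_top_def split: option.splits)

end

theory Submission
  imports Defs
begin

text \<open>The stabilizer of a chain in \<open>E\<O>\<close> is that of its first vertex \<open>(H, a)\<close>, so
  \<open>[E\<O>\<^sub>n] = \<Sum>\<^sub>H c\<^sub>n(H) [G/H]\<close>, where \<open>c\<^sub>n(H)\<close> counts the nondegenerate chains of the orbit category
  starting at \<open>H\<close>. There is exactly one morphism \<open>(H, a) \<rightarrow> (K, b)\<close> if the stabilizer of \<open>a\<close> is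
  contained in that of \<open>b\<close>, and none otherwise, and every \<open>L \<in> \<C>\<close> is the stabilizer of \<open>|G : L|\<close>
  objects. Hence the generating functions \<open>F\<^sub>H(t) = \<Sum>\<^sub>n c\<^sub>n(H) t\<^sup>n\<close> satisfy
  \<open>(1 + t - |G : H| t) F\<^sub>H = 1 + t (\<Sum>K \<supset> H. |G : K| F\<^sub>K)\<close>. They are therefore rational and regular at
  \<open>-1\<close>, and \<open>\<Sum>K \<supseteq> H. |G : K| F\<^sub>K(-1) = 1\<close>. This is the dual recursion for \<open>-\<mu>(H, \<infinity>)\<close>.\<close>


section \<open>Rational functions regular at minus one\<close>

text \<open>Membership of \<open>f\<close> in the local ring at t = -1, with value \<open>v\<close>
  there. The equations are cross-multiplied to avoid dividing power series; they determine
  \<open>v\<close>, since two quotients for the same \<open>f\<close> agree at -1.\<close>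

definition poly_quotient_value :: "rat fps \<Rightarrow> rat \<Rightarrow> bool" where
  "poly_quotient_value f v \<longleftrightarrow>
     (\<exists>p q. poly q (-1) \<noteq> 0 \<and> fps_of_poly q * f = fps_of_poly p \<and> poly q (-1) * v = poly p (-1))"

lemma linear_factor_dvd_iff: "[:1, 1:] dvd (q :: rat poly) \<longleftrightarrow> poly q (-1) = 0"
  using poly_eq_0_iff_dvd[of q "-1"] by simp

lemma poly_quotient_value_fract:
  assumes "poly_quotient_value f v"
  shows "\<exists>r \<in> rational_functions_at_minus_one.
    laurent_of_fract r = fps_to_fls f \<and> fract_at_minus_one r = v"
proof -
  obtain p q where pq: "poly q (-1) \<noteq> 0" "fps_of_poly q * f = fps_of_poly p"
      "poly q (-1) * v = poly p (-1)"
    using assms by (auto simp: poly_quotient_value_def)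
  then have nd: "\<not> [:1, 1:] dvd q" and q0: "q \<noteq> 0"
    by (auto simp: linear_factor_dvd_iff)
  have "fps_to_fls (fps_of_poly p) = fps_to_fls (fps_of_poly q) * fps_to_fls f"
    by (simp add: fls_times_fps_to_fls flip: pq(2))
  moreover have "fps_to_fls (fps_of_poly q) \<noteq> 0"
    using q0 by (auto simp: fps_to_fls_eq_0_iff)
  ultimately have "laurent_of_fract (Fract p q) = fps_to_fls f"
    by (simp add: laurent_of_fract_Fract[OF q0])
  moreover have "fract_at_minus_one (Fract p q) = v"
    using pq by (simp add: fract_at_minus_one_Fract[OF nd] field_simps)
  ultimately show ?thesis
    using nd by (auto simp: rational_functions_at_minus_one_def)
qed

lemma poly_quotient_value_poly: "poly_quotient_value (fps_of_poly p) (poly p (-1))"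
  unfolding poly_quotient_value_def by (intro exI[of _ p] exI[of _ 1]) simp

lemma poly_quotient_value_add:
  assumes "poly_quotient_value f v" "poly_quotient_value g w"
  shows "poly_quotient_value (f + g) (v + w)"
proof -
  obtain p q where pq: "poly q (-1) \<noteq> 0" "fps_of_poly q * f = fps_of_poly p"
      "poly q (-1) * v = poly p (-1)"
    using assms(1) by (auto simp: poly_quotient_value_def)
  obtain p' q' where pq': "poly q' (-1) \<noteq> 0" "fps_of_poly q' * g = fps_of_poly p'"
      "poly q' (-1) * w = poly p' (-1)"
    using assms(2) by (auto simp: poly_quotient_value_def)
  show ?thesis
    unfolding poly_quotient_value_def
  proof (rule exI[of _ "q' * p + q * p'"], rule exI[of _ "q * q'"], intro conjI)
    show "fps_of_poly (q * q') * (f + g) = fps_of_poly (q' * p + q * p')"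
      by (simp add: fps_of_poly_mult fps_of_poly_add algebra_simps flip: pq(2) pq'(2))
    show "poly (q * q') (-1) * (v + w) = poly (q' * p + q * p') (-1)"
      by (simp add: algebra_simps flip: pq(3) pq'(3))
  qed (use pq pq' in auto)
qed

lemma poly_quotient_value_mult:
  assumes "poly_quotient_value f v"
  shows "poly_quotient_value (fps_of_poly d * f) (poly d (-1) * v)"
proof -
  obtain p q where pq: "poly q (-1) \<noteq> 0" "fps_of_poly q * f = fps_of_poly p"
      "poly q (-1) * v = poly p (-1)"
    using assms(1) by (auto simp: poly_quotient_value_def)
  then show ?thesis
    unfolding poly_quotient_value_def
    by (intro exI[of _ "d * p"] exI[of _ q]) (simp add: fps_of_poly_mult algebra_simps)
qed

lemma poly_quotient_value_sum:
  assumes "\<And>i. i \<in> A \<Longrightarrow> poly_quotient_value (f i) (v i)"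
  shows "poly_quotient_value (\<Sum>i\<in>A. f i) (\<Sum>i\<in>A. v i)"
  using assms
proof (induction A rule: infinite_finite_induct)
  case (insert i A)
  then show ?case
    by (simp add: poly_quotient_value_add)
qed (use poly_quotient_value_poly[of 0] in auto)

text \<open>Used to solve \<open>d * f = g\<close> for \<open>f\<close>: a polynomial that does not
  vanish at -1 is a unit of the local ring.\<close>

lemma poly_quotient_value_divide:
  assumes "poly_quotient_value (fps_of_poly d * f) v" and "poly d (-1) \<noteq> 0"
  shows "poly_quotient_value f (v / poly d (-1))"
proof -
  obtain p q where pq: "poly q (-1) \<noteq> 0" "fps_of_poly q * (fps_of_poly d * f) = fps_of_poly p"
      "poly q (-1) * v = poly p (-1)"
    using assms(1) by (auto simp: poly_quotient_value_def)
  then show ?thesis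
    unfolding poly_quotient_value_def using assms(2)
    by (intro exI[of _ p] exI[of _ "q * d"]) (simp add: fps_of_poly_mult algebra_simps)
qed

text \<open>The product of the denominators works. The numerators stay existentially quantified in
  the induction because each new denominator rescales them; a choice function collects them at the
  end.\<close>

lemma common_denominator:
  assumes "finite A" "\<And>i. i \<in> A \<Longrightarrow> r i \<in> rational_functions_at_minus_one"
  shows "\<exists>q p. poly q (-1) \<noteq> 0 \<and> (\<forall>i\<in>A.
    fps_to_fls (fps_of_poly q) * laurent_of_fract (r i) = fps_to_fls (fps_of_poly (p i)) \<and>
    poly q (-1) * fract_at_minus_one (r i) = poly (p i) (-1))"
proof -
  let ?P = "\<lambda>q i p. fps_to_fls (fps_of_poly q) * laurent_of_fract (r i) = fps_to_fls (fps_of_poly p)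
    \<and> poly q (-1) * fract_at_minus_one (r i) = poly p (-1)"
  have "\<exists>q. poly q (-1) \<noteq> 0 \<and> (\<forall>i\<in>A. \<exists>p. ?P q i p)"
    using assms
  proof (induction A rule: finite_induct)
    case empty
    then show ?case
      by (intro exI[of _ 1]) auto
  next
    case (insert j A)
    then obtain q where q: "poly q (-1) \<noteq> 0" "\<forall>i\<in>A. \<exists>p. ?P q i p"
      by auto
    obtain a b where ab: "r j = Fract a b" "\<not> [:1, 1:] dvd b"
      using insert.prems[of j] by (auto simp: rational_functions_at_minus_one_def)
    then have b: "poly b (-1) \<noteq> 0" "b \<noteq> 0"
      by (auto simp: linear_factor_dvd_iff)
    have "?P (b * q) j (q * a)"
      using b by (simp add: ab(1) laurent_of_fract_Fract fract_at_minus_one_Fract ab(2)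
          fps_of_poly_mult fls_times_fps_to_fls)
    moreover have "\<exists>p. ?P (b * q) i p" if i: "i \<in> A" for i
    proof -
      obtain p where "?P q i p"
        using q i by auto
      then have "?P (b * q) i (b * p)"
        by (simp add: fps_of_poly_mult fls_times_fps_to_fls mult.assoc)
      then show ?thesis
        by blast
    qed
    ultimately show ?case
      using q b by (intro exI[of _ "b * q"]) auto
  qed
  then obtain q where q: "poly q (-1) \<noteq> 0" "\<forall>i\<in>A. \<exists>p. ?P q i p"
    by blast
  show ?thesis
    using q(1) bchoice[OF q(2)] by blast
qed

text \<open>Multiplying by \<open>fls_X\<close> only shifts coefficients, so every coefficient of
  the product is a linear combination of elements already in \<open>S\<close>. The index
  \<open>k\<close> is generalised because the shift reads position \<open>k - 1\<close>.\<close>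

lemma (in module) laurent_combination_poly_mult:
  fixes g :: "'i \<Rightarrow> 'a fls"
  assumes "subspace S" and "\<And>k. (\<Sum>i\<in>A. fls_nth (g i) k *s u i) \<in> S"
  shows "(\<Sum>i\<in>A. fls_nth (fps_to_fls (fps_of_poly q) * g i) k *s u i) \<in> S"
proof (induction q arbitrary: k)
  case 0
  then show ?case
    using assms by (simp add: subspace_0)
next
  case (pCons a q)
  have "fps_to_fls (fps_of_poly (pCons a q)) = fls_const a + fls_X * fps_to_fls (fps_of_poly q)"
    by (simp only: fps_of_poly_pCons fps_to_fls_plus fls_times_fps_to_fls fps_const_to_fls
        fps_X_to_fls mult.commute[of _ fls_X])
  then have "fps_to_fls (fps_of_poly (pCons a q)) * g i =
      fls_const a * g i + fls_shift (-1) (fps_to_fls (fps_of_poly q) * g i)" for i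
    by (simp only: distrib_right mult.assoc flip: fls_X_times_conv_shift(1))
  then have "fls_nth (fps_to_fls (fps_of_poly (pCons a q)) * g i) k =
      a * fls_nth (g i) k + fls_nth (fps_to_fls (fps_of_poly q) * g i) (k - 1)" for i
    by simp
  then have "(\<Sum>i\<in>A. fls_nth (fps_to_fls (fps_of_poly (pCons a q)) * g i) k *s u i) =
      a *s (\<Sum>i\<in>A. fls_nth (g i) k *s u i) +
      (\<Sum>i\<in>A. fls_nth (fps_to_fls (fps_of_poly q) * g i) (k - 1) *s u i)"
    by (simp add: scale_left_distrib sum.distrib scale_sum_right)
  then show ?case
    using assms pCons.IH by (simp add: subspace_add subspace_scale)
qed

text \<open>Uniqueness of the value at \<open>-1\<close>: after multiplication by a common denominator only
  polynomials remain, and a polynomial is evaluated by a finite linear combination of its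
  coefficients.\<close>

lemma value_at_minus_one_in_subspace:
  fixes scale :: "rat \<Rightarrow> 'b \<Rightarrow> 'b::ab_group_add"
  assumes "vector_space scale" and S: "module.subspace scale S"
    and A: "finite A" and r: "\<And>i. i \<in> A \<Longrightarrow> r i \<in> rational_functions_at_minus_one"
    and coeffs: "\<And>k. (\<Sum>i\<in>A. scale (fls_nth (laurent_of_fract (r i)) k) (u i)) \<in> S"
  shows "(\<Sum>i\<in>A. scale (fract_at_minus_one (r i)) (u i)) \<in> S"
proof -
  interpret vector_space scale by fact
  obtain q p where q: "poly q (-1) \<noteq> 0" and pq: "\<forall>i\<in>A.
      fps_to_fls (fps_of_poly q) * laurent_of_fract (r i) = fps_to_fls (fps_of_poly (p i)) \<and>
      poly q (-1) * fract_at_minus_one (r i) = poly (p i) (-1)"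
    using common_denominator[OF A, of r, OF r] by blast
  have coeff_S: "(\<Sum>i\<in>A. scale (coeff (p i) k) (u i)) \<in> S" for k
  proof -
    have "(\<Sum>i\<in>A. scale (coeff (p i) k) (u i)) =
        (\<Sum>i\<in>A. scale (fls_nth (fps_to_fls (fps_of_poly q) * laurent_of_fract (r i)) (int k)) (u i))"
      by (rule sum.cong) (simp_all add: pq)
    with laurent_combination_poly_mult[OF S coeffs] show ?thesis
      by simp
  qed
  \<comment> \<open>A common bound on the degrees, so that the same range of coefficients evaluates
    every numerator and the two sums can be exchanged.\<close>
  define N where "N = (\<Sum>i\<in>A. degree (p i))"
  have poly_p: "poly (p i) (-1) = (\<Sum>k\<le>N. (-1) ^ k * coeff (p i) k)" if "i \<in> A" for i
  proof -
    have "degree (p i) \<le> N"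
      unfolding N_def using A that by (intro member_le_sum) auto
    then have "poly (p i) (-1) = poly (\<Sum>k\<le>N. monom (coeff (p i) k) k) (-1)"
      by (simp add: poly_as_sum_of_monoms')
    then show ?thesis
      by (simp add: poly_sum poly_monom mult.commute)
  qed
  have "scale (poly q (-1)) (\<Sum>i\<in>A. scale (fract_at_minus_one (r i)) (u i)) =
      (\<Sum>i\<in>A. scale (poly (p i) (-1)) (u i))"
    by (simp add: scale_sum_right pq)
  also have "\<dots> = (\<Sum>i\<in>A. \<Sum>k\<le>N. scale ((-1) ^ k) (scale (coeff (p i) k) (u i)))"
    by (simp add: poly_p scale_sum_left)
  also have "\<dots> = (\<Sum>k\<le>N. scale ((-1) ^ k) (\<Sum>i\<in>A. scale (coeff (p i) k) (u i)))"
    by (subst sum.swap) (simp add: scale_sum_right)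
  also have "\<dots> \<in> S"
    by (rule subspace_sum[OF S]) (rule subspace_scale[OF S coeff_S])
  finally have "scale (inverse (poly q (-1)))
      (scale (poly q (-1)) (\<Sum>i\<in>A. scale (fract_at_minus_one (r i)) (u i))) \<in> S"
    by (rule subspace_scale[OF S])
  then show ?thesis
    using q by simp
qed


section \<open>The dual recursion of the Moebius function\<close>

text \<open>The definition makes \<open>moebius\<close> a one-sided inverse of the zeta function in
  the incidence algebra, by summing over the second argument; this is the other side. With S(w) the
  sum in question started at w, the sum of \<mu>(x, w) S(w) over the interval is evaluated in two
  ways.\<close>

lemma moebius_dual_recursion:
  fixes P (structure)
  assumes P: "partial_order P" and fin: "finite (carrier P)"
    and x: "x \<in> carrier P" and y: "y \<in> carrier P" and "x \<sqsubseteq> y" "x \<noteq> y"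
  shows "(\<Sum>z\<in>{z \<in> carrier P. x \<sqsubseteq> z \<and> z \<sqsubseteq> y}. moebius P z y) = 0"
  using x \<open>x \<sqsubseteq> y\<close> \<open>x \<noteq> y\<close>
proof (induction "card {w \<in> carrier P. x \<sqsubseteq> w}" arbitrary: x rule: less_induct)
  case less
  interpret partial_order P by fact
  let ?I = "\<lambda>x y. {z \<in> carrier P. x \<sqsubseteq> z \<and> z \<sqsubseteq> y}"
  let ?S = "\<lambda>w. \<Sum>z\<in>?I w y. moebius P z y"
  have finI: "finite (?I a b)" for a b
    using fin by simp
  have rec: "(\<Sum>w\<in>?I x z. moebius P x w) = (if x = z then 1 else 0)"
    if z: "z \<in> carrier P" "x \<sqsubseteq> z" for z
  proof (cases "x = z")
    case True
    then have "?I x z = {x}"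
      using less.prems le_antisym by auto
    with True z show ?thesis
      using fin P by (simp add: moebius.simps)
  next
    case False
    have "?I x z = insert z {w \<in> carrier P. x \<sqsubseteq> w \<and> w \<sqsubseteq> z \<and> w \<noteq> z}"
      using z by auto
    then have "(\<Sum>w\<in>?I x z. moebius P x w) = moebius P x z +
        (\<Sum>w\<in>{w \<in> carrier P. x \<sqsubseteq> w \<and> w \<sqsubseteq> z \<and> w \<noteq> z}. moebius P x w)"
      using fin by simp
    with False z show ?thesis
      using less.prems fin P by (simp add: moebius.simps[of P x z])
  qed
  \<comment> \<open>Strictly between \<open>x\<close> and \<open>y\<close> there are fewer elements
    above \<open>w\<close> than above \<open>x\<close>, so the induction hypothesis applies.\<close>
  have S0: "?S w = 0" if w: "w \<in> ?I x y - {x, y}" for w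
  proof (rule less.hyps)
    have "{v \<in> carrier P. w \<sqsubseteq> v} \<subseteq> {v \<in> carrier P. x \<sqsubseteq> v}"
      using w less.prems le_trans by blast
    moreover have "x \<notin> {v \<in> carrier P. w \<sqsubseteq> v}" "x \<in> {v \<in> carrier P. x \<sqsubseteq> v}"
      using w less.prems le_antisym by auto
    ultimately show "card {v \<in> carrier P. w \<sqsubseteq> v} < card {v \<in> carrier P. x \<sqsubseteq> v}"
      using fin by (intro psubset_card_mono) auto
  qed (use w in auto)
  have "?I y y = {y}"
    using y le_antisym by auto
  then have Sy: "?S y = 1"
    using y fin P by (simp add: moebius.simps)
  \<comment> \<open>First evaluation: exchange the sums; by \<open>rec\<close> the inner sum is 1 at
    \<open>z = x\<close> and 0 elsewhere.\<close>
  have "(\<Sum>w\<in>?I x y. moebius P x w * ?S w) =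
      (\<Sum>w\<in>?I x y. \<Sum>z | z \<in> ?I x y \<and> w \<sqsubseteq> z. moebius P x w * moebius P z y)"
    using less.prems le_trans
    by (intro sum.cong refl) (auto simp: sum_distrib_left intro!: sum.cong)
  also have "\<dots> = (\<Sum>z\<in>?I x y. \<Sum>w | w \<in> ?I x y \<and> w \<sqsubseteq> z. moebius P x w * moebius P z y)"
    using sum.swap_restrict[OF finI finI,
        where R = "\<lambda>w z. w \<sqsubseteq> z" and g = "\<lambda>w z. moebius P x w * moebius P z y"]
    by simp
  also have "\<dots> = (\<Sum>z\<in>?I x y. (\<Sum>w\<in>?I x z. moebius P x w) * moebius P z y)"
    using y le_trans
    by (intro sum.cong refl) (auto simp: sum_distrib_right intro!: sum.cong)
  also have "\<dots> = (\<Sum>z\<in>?I x y. if x = z then moebius P x y else 0)"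
    by (intro sum.cong refl) (simp_all add: rec)
  also have "\<dots> = moebius P x y"
    using less.prems fin by simp
  finally have conv: "(\<Sum>w\<in>?I x y. moebius P x w * ?S w) = moebius P x y" .
  \<comment> \<open>Second evaluation: only the endpoints survive, giving
    \<open>?S x + moebius P x y\<close>. Comparison leaves \<open>?S x = 0\<close>.\<close>
  have "(\<Sum>w\<in>?I x y. moebius P x w * ?S w) =
      (\<Sum>w\<in>{x, y}. moebius P x w * ?S w)"
    using less.prems y finI S0 by (intro sum.mono_neutral_right) auto
  also have "\<dots> = ?S x + moebius P x y"
    using less.prems Sy fin P by (simp add: moebius.simps[of P x x])
  finally show ?case
    using conv by simp
qed

text \<open>The interval from H to \<infinity> consists of the members of \<C> containing H and of
  \<infinity> itself, whose term is 1.\<close>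

lemma sum_moebius_adjoin_top:
  assumes "finite \<C>" "H \<in> \<C>"
  shows "(\<Sum>K\<in>{K \<in> \<C>. H \<subseteq> K}. moebius (adjoin_top \<C>) (Some K) None) = -1"
proof -
  let ?P = "adjoin_top \<C>"
  have fin: "finite (carrier ?P)"
    using assms by (simp add: adjoin_top_def)
  have "moebius ?P None None = 1"
    using fin partial_order_adjoin_top[of \<C>]
    by (subst moebius.simps) (simp add: adjoin_top_def)
  moreover have "{z \<in> carrier ?P. Some H \<sqsubseteq>\<^bsub>?P\<^esub> z \<and> z \<sqsubseteq>\<^bsub>?P\<^esub> None} =
      insert None (Some ` {K \<in> \<C>. H \<subseteq> K})"
    by (auto simp: adjoin_top_def)
  moreover have "(\<Sum>z\<in>{z \<in> carrier ?P. Some H \<sqsubseteq>\<^bsub>?P\<^esub> z \<and> z \<sqsubseteq>\<^bsub>?P\<^esub> None}. moebius ?P z None) = 0"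
    using fin assms by (intro moebius_dual_recursion partial_order_adjoin_top)
      (auto simp: adjoin_top_def)
  ultimately show ?thesis
    using assms by (simp add: sum.reindex)
qed


section \<open>The Burnside ring as a quotient vector space\<close>

abbreviation scale_pm :: "rat \<Rightarrow> ('a \<Rightarrow>\<^sub>0 rat) \<Rightarrow> ('a \<Rightarrow>\<^sub>0 rat)" where
  "scale_pm c \<equiv> Poly_Mapping.map ((*) c)"

lemma lookup_scale_pm: "Poly_Mapping.lookup (scale_pm c u) k = c * Poly_Mapping.lookup u k"
  by (simp add: Poly_Mapping.map.rep_eq when_def)

lemma vector_space_scale_pm: "vector_space (scale_pm :: rat \<Rightarrow> ('a \<Rightarrow>\<^sub>0 rat) \<Rightarrow> _)"
  by unfold_locales
    (auto intro!: poly_mapping_eqI simp: lookup_scale_pm lookup_add algebra_simps)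

interpretation pm: vector_space "scale_pm :: rat \<Rightarrow> ('a \<Rightarrow>\<^sub>0 rat) \<Rightarrow> _"
  by (rule vector_space_scale_pm)

lemma keys_scale_pm: "Poly_Mapping.keys (scale_pm c u) \<subseteq> Poly_Mapping.keys u"
  by (auto simp: lookup_scale_pm simp flip: lookup_not_eq_zero_eq_in_keys)

text \<open>Makes membership in the ideal a question of rational linear algebra.\<close>

lemma burnside_ideal_eq_span: "burnside_ideal G = pm.span (burnside_relations G)"
  by (auto simp: burnside_ideal_def pm.span_explicit)

lemma subspace_burnside_ideal: "pm.subspace (burnside_ideal G)"
  by (simp add: burnside_ideal_eq_span)

section \<open>Arithmetic of cosets of the relation space\<close>

abbreviation burnside_coset ::
    "('g, 'b) monoid_scheme \<Rightarrow> ('g gset set \<Rightarrow>\<^sub>0 rat) \<Rightarrow> ('g gset set \<Rightarrow>\<^sub>0 rat) set" where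
  "burnside_coset G u \<equiv> burnside_ideal G +>\<^bsub>gset_algebra G\<^esub> u"

abbreviation gset_vectors :: "('g, 'b) monoid_scheme \<Rightarrow> ('g gset set \<Rightarrow>\<^sub>0 rat) set" where
  "gset_vectors G \<equiv> carrier (gset_algebra G)"

lemma gset_vectors_iff: "u \<in> gset_vectors G \<longleftrightarrow> Poly_Mapping.keys u \<subseteq> gset_classes G"
  by (simp add: gset_algebra_def)

lemma subspace_gset_vectors: "pm.subspace (gset_vectors G)"
  by (auto simp: pm.subspace_def gset_vectors_iff dest!: subsetD[OF Poly_Mapping.keys_add] subsetD[OF keys_scale_pm])

lemma burnside_coset_eq_image: "burnside_coset G u = (\<lambda>v. v + u) ` burnside_ideal G"
  by (auto simp: a_r_coset_def' gset_algebra_def)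

lemma mem_burnside_coset_iff: "v \<in> burnside_coset G u \<longleftrightarrow> v - u \<in> burnside_ideal G"
  by (auto simp: burnside_coset_eq_image intro: image_eqI[of _ _ "v - u"])

lemma burnside_coset_eq_iff: "burnside_coset G u = burnside_coset G v \<longleftrightarrow> u - v \<in> burnside_ideal G"
proof
  assume "burnside_coset G u = burnside_coset G v"
  moreover have "u \<in> burnside_coset G u"
    by (simp add: mem_burnside_coset_iff pm.subspace_0[OF subspace_burnside_ideal])
  ultimately show "u - v \<in> burnside_ideal G"
    by (simp add: mem_burnside_coset_iff)
next
  assume uv: "u - v \<in> burnside_ideal G"
  have "w - u \<in> burnside_ideal G \<longleftrightarrow> w - v \<in> burnside_ideal G" for w
    using pm.subspace_add[OF subspace_burnside_ideal _ uv, of "w - u"]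
      pm.subspace_diff[OF subspace_burnside_ideal _ uv, of "w - v"] by auto
  then show "burnside_coset G u = burnside_coset G v"
    by (auto simp: mem_burnside_coset_iff)
qed

lemma carrier_burnside_ring: "carrier (\<Omega> G) = burnside_coset G ` gset_vectors G"
  by (auto simp: burnside_ring_def ring.extend_def FactRing_def A_RCOSETS_def')

lemma zero_burnside_ring: "\<zero>\<^bsub>\<Omega> G\<^esub> = burnside_coset G 0"
  by (simp add: burnside_ring_def ring.extend_def FactRing_def burnside_coset_eq_image)

lemma add_burnside_coset:
  "burnside_coset G u \<oplus>\<^bsub>\<Omega> G\<^esub> burnside_coset G v = burnside_coset G (u + v)"
proof -
  note I = subspace_burnside_ideal[of G]
  have "burnside_coset G u \<oplus>\<^bsub>\<Omega> G\<^esub> burnside_coset G v =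
      {a + b | a b. a \<in> burnside_coset G u \<and> b \<in> burnside_coset G v}"
    by (auto simp: burnside_ring_def ring.extend_def FactRing_def set_add_defs gset_algebra_def)
  also have "\<dots> = burnside_coset G (u + v)"
  proof safe
    fix a b assume "a \<in> burnside_coset G u" "b \<in> burnside_coset G v"
    then show "a + b \<in> burnside_coset G (u + v)"
      unfolding mem_burnside_coset_iff using pm.subspace_add[OF I] by (metis add_diff_add)
  next
    fix w assume "w \<in> burnside_coset G (u + v)"
    then show "\<exists>a b. w = a + b \<and> a \<in> burnside_coset G u \<and> b \<in> burnside_coset G v"
      unfolding mem_burnside_coset_iff using pm.subspace_0[OF I]
      by (intro exI[of _ "w - v"] exI[of _ v]) (simp add: algebra_simps)
  qed
  finally show ?thesis .
qed

text \<open>Scalar multiplication is a union over all representatives; it collapses to one coset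
  because the scaled representatives still differ by elements of the ideal.\<close>

lemma smult_burnside_coset:
  "c \<odot>\<^bsub>\<Omega> G\<^esub> burnside_coset G u = burnside_coset G (scale_pm c u)"
proof -
  have "burnside_coset G (scale_pm c w) = burnside_coset G (scale_pm c u)"
    if "w \<in> burnside_coset G u" for w
    using that pm.subspace_scale[OF subspace_burnside_ideal[of G], of "w - u" c]
    by (simp add: burnside_coset_eq_iff mem_burnside_coset_iff pm.scale_right_diff_distrib)
  moreover have "u \<in> burnside_coset G u"
    by (simp add: mem_burnside_coset_iff pm.subspace_0[OF subspace_burnside_ideal])
  moreover have "c \<odot>\<^bsub>\<Omega> G\<^esub> burnside_coset G u =
      (\<Union>w\<in>burnside_coset G u. burnside_coset G (scale_pm c w))"
    by (simp add: burnside_ring_def ring.extend_def)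
  ultimately show ?thesis
    by blast
qed

lemma abelian_monoid_burnside_ring: "abelian_monoid (\<Omega> G)"
proof (rule abelian_monoidI)
  note V = subspace_gset_vectors[of G]
  show "\<zero>\<^bsub>\<Omega> G\<^esub> \<in> carrier (\<Omega> G)"
    unfolding zero_burnside_ring carrier_burnside_ring using pm.subspace_0[OF V] by (rule imageI)
  show "x \<oplus>\<^bsub>\<Omega> G\<^esub> y \<in> carrier (\<Omega> G)" if "x \<in> carrier (\<Omega> G)" "y \<in> carrier (\<Omega> G)" for x y
    using that pm.subspace_add[OF V] by (auto simp: carrier_burnside_ring add_burnside_coset)
qed (auto simp: carrier_burnside_ring add_burnside_coset zero_burnside_ring ac_simps)

text \<open>Transfers finite sums in \<Omega>(G) to sums of vectors, so that the linear algebra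
  takes place before passing to the quotient.\<close>

lemma finsum_burnside_ring:
  assumes "finite A" "\<And>i. i \<in> A \<Longrightarrow> u i \<in> gset_vectors G"
  shows "(\<Oplus>\<^bsub>\<Omega> G\<^esub>i\<in>A. c i \<odot>\<^bsub>\<Omega> G\<^esub> burnside_coset G (u i)) =
    burnside_coset G (\<Sum>i\<in>A. scale_pm (c i) (u i))"
proof -
  interpret abelian_monoid "\<Omega> G"
    by (rule abelian_monoid_burnside_ring)
  have closed: "burnside_coset G (scale_pm a v) \<in> carrier (\<Omega> G)" if "v \<in> gset_vectors G" for a v
    unfolding carrier_burnside_ring
    using pm.subspace_scale[OF subspace_gset_vectors that] by (rule imageI)
  show ?thesis
    using assms
  proof (induction A rule: finite_induct)
    case empty
    then show ?case
      by (simp add: zero_burnside_ring)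
  next
    case (insert i A)
    then show ?case
      using closed by (simp add: smult_burnside_coset add_burnside_coset Pi_iff)
  qed
qed

text \<open>Both tensors are lifted to vectors and subtracted. All Laurent coefficients of the
  difference lie in the ideal, hence so does its value at -1.\<close>

lemma represents_unique:
  assumes "represents G f n x r" "represents G f n' x' r'"
  shows "(\<Oplus>\<^bsub>\<Omega> G\<^esub>i\<in>{..<n}. fract_at_minus_one (r i) \<odot>\<^bsub>\<Omega> G\<^esub> x i) =
    (\<Oplus>\<^bsub>\<Omega> G\<^esub>i\<in>{..<n'}. fract_at_minus_one (r' i) \<odot>\<^bsub>\<Omega> G\<^esub> x' i)"
proof -
  have lift: "\<exists>u. \<forall>i<n. u i \<in> gset_vectors G \<and> x i = burnside_coset G (u i)"
    if "represents G f n x r" for n x r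
  proof -
    have "\<forall>i\<in>{..<n}. \<exists>v. v \<in> gset_vectors G \<and> x i = burnside_coset G v"
      using that by (auto simp: represents_def carrier_burnside_ring)
    from bchoice[OF this] show ?thesis
      by auto
  qed
  have combination: "(\<Oplus>\<^bsub>\<Omega> G\<^esub>i\<in>{..<n}. c i \<odot>\<^bsub>\<Omega> G\<^esub> x i) =
      burnside_coset G (\<Sum>i<n. scale_pm (c i) (u i))"
    if "\<forall>i<n. u i \<in> gset_vectors G \<and> x i = burnside_coset G (u i)" for n :: nat and x u c
  proof -
    interpret abelian_monoid "\<Omega> G"
      by (rule abelian_monoid_burnside_ring)
    have "(\<Oplus>\<^bsub>\<Omega> G\<^esub>i\<in>{..<n}. c i \<odot>\<^bsub>\<Omega> G\<^esub> x i) =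
        (\<Oplus>\<^bsub>\<Omega> G\<^esub>i\<in>{..<n}. c i \<odot>\<^bsub>\<Omega> G\<^esub> burnside_coset G (u i))"
    proof (rule finsum_cong')
      show "(\<lambda>i. c i \<odot>\<^bsub>\<Omega> G\<^esub> burnside_coset G (u i)) \<in> {..<n} \<rightarrow> carrier (\<Omega> G)"
        using that
        by (auto simp: smult_burnside_coset carrier_burnside_ring
            intro!: imageI pm.subspace_scale[OF subspace_gset_vectors])
    qed (use that in auto)
    also have "\<dots> = burnside_coset G (\<Sum>i<n. scale_pm (c i) (u i))"
      by (rule finsum_burnside_ring) (use that in auto)
    finally show ?thesis .
  qed
  obtain u where u: "\<forall>i<n. u i \<in> gset_vectors G \<and> x i = burnside_coset G (u i)"
    using lift[OF assms(1)] by blast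
  obtain u' where u': "\<forall>i<n'. u' i \<in> gset_vectors G \<and> x' i = burnside_coset G (u' i)"
    using lift[OF assms(2)] by blast
  \<comment> \<open>The difference is one family over the disjoint union of the index sets, with the
    second family of vectors negated.\<close>
  let ?A = "{..<n} <+> {..<n'}"
  let ?r = "case_sum r r'" and ?u = "case_sum u (\<lambda>i. - u' i)"
  have split: "(\<Sum>i\<in>?A. scale_pm (c i) (?u i)) =
      (\<Sum>i<n. scale_pm (c (Inl i)) (u i)) - (\<Sum>i<n'. scale_pm (c (Inr i)) (u' i))" for c
    by (simp add: sum.Plus sum_negf)
  have "(\<Sum>i\<in>?A. scale_pm (fract_at_minus_one (?r i)) (?u i)) \<in> burnside_ideal G"
  proof (rule value_at_minus_one_in_subspace[OF vector_space_scale_pm subspace_burnside_ideal])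
    show "(\<Sum>i\<in>?A. scale_pm (fls_nth (laurent_of_fract (?r i)) k) (?u i)) \<in> burnside_ideal G" for k
      using assms unfolding split
      by (simp add: represents_def combination[OF u] combination[OF u'] flip: burnside_coset_eq_iff)
  qed (use assms in \<open>auto simp: represents_def\<close>)
  then show ?thesis
    unfolding split by (simp add: combination[OF u] combination[OF u'] burnside_coset_eq_iff)
qed

lemma value_at_minus_one_eq:
  assumes "represents G f n x r"
  shows "value_at_minus_one G f = (\<Oplus>\<^bsub>\<Omega> G\<^esub>i\<in>{..<n}. fract_at_minus_one (r i) \<odot>\<^bsub>\<Omega> G\<^esub> x i)"
  unfolding value_at_minus_one_def using assms represents_unique[OF assms] by (intro the_equality) blast+


section \<open>Classes of finite G-sets\<close>

lemma gset_iso_trans: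
  assumes "gset_iso G X \<phi> Y \<psi>" "gset_iso G Y \<psi> Z \<chi>"
  shows "gset_iso G X \<phi> Z \<chi>"
proof -
  obtain f where f: "bij_betw f X Y" "\<forall>g\<in>carrier G. \<forall>x\<in>X. f (\<phi> g x) = \<psi> g (f x)"
    using assms(1) by (auto simp: gset_iso_def)
  obtain h where h: "bij_betw h Y Z" "\<forall>g\<in>carrier G. \<forall>y\<in>Y. h (\<psi> g y) = \<chi> g (h y)"
    using assms(2) by (auto simp: gset_iso_def)
  show ?thesis
    unfolding gset_iso_def
    by (rule exI[of _ "h \<circ> f"]) (use f h bij_betw_trans in \<open>auto simp: bij_betwE\<close>)
qed

text \<open>The inverse of \<open>f\<close> cancels \<open>f\<close> only on \<open>X\<close>, so
  \<open>X\<close> has to be closed under the action; this is where \<open>\<phi>\<close> being an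
  action enters.\<close>

lemma gset_iso_sym:
  assumes "group_action G X \<phi>" "gset_iso G X \<phi> Y \<psi>"
  shows "gset_iso G Y \<psi> X \<phi>"
proof -
  obtain f where f: "bij_betw f X Y" "\<forall>g\<in>carrier G. \<forall>x\<in>X. f (\<phi> g x) = \<psi> g (f x)"
    using assms(2) by (auto simp: gset_iso_def)
  have "inv_into X f (\<psi> g y) = \<phi> g (inv_into X f y)" if "g \<in> carrier G" "y \<in> Y" for g y
  proof -
    have x: "inv_into X f y \<in> X" "f (inv_into X f y) = y"
      using f(1) that by (auto simp: bij_betw_def inv_into_into f_inv_into_f)
    then have "\<psi> g y = f (\<phi> g (inv_into X f y))"
      using f(2) that by simp
    then show ?thesis
      using f(1) group_action.element_image[OF assms(1) that(1) x(1) refl]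
      by (simp add: bij_betw_def)
  qed
  then show ?thesis
    unfolding gset_iso_def using bij_betw_inv_into[OF f(1)] by blast
qed

lemma gset_class_cong:
  assumes "group_action G X \<phi>" "gset_iso G X \<phi> Y \<psi>"
  shows "gset_class G X \<phi> = gset_class G Y \<psi>"
  unfolding gset_class_def
  by (auto intro: gset_iso_trans[OF assms(2)] gset_iso_trans[OF gset_iso_sym[OF assms]])

text \<open>Transport of structure along a bijection. It links G-sets over arbitrary types to
  \<open>gset_classes\<close>, which is built from sets of natural numbers.\<close>

lemma finite_gset_nat:
  assumes "finite_gset G X \<phi>"
  shows "\<exists>(Y :: nat set) \<psi>. finite_gset G Y \<psi> \<and> gset_iso G X \<phi> Y \<psi>"
proof -
  have act: "group_action G X \<phi>" and fin: "finite X"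
    using assms by (simp_all add: finite_gset_def)
  interpret group_action G X \<phi> by fact
  obtain f and Y :: "nat set" where f: "bij_betw f X Y"
    using ex_bij_betw_finite_nat[OF fin] by blast
  define \<psi> where "\<psi> g = (\<lambda>y\<in>Y. f (\<phi> g (inv_into X f y)))" for g
  have inv: "inv_into X f y \<in> X" "f (inv_into X f y) = y" if "y \<in> Y" for y
    using f that by (auto simp: bij_betw_def inv_into_into f_inv_into_f)
  have fX: "f x \<in> Y" "inv_into X f (f x) = x" if "x \<in> X" for x
    using f that by (auto simp: bij_betw_def)
  have closed: "\<phi> g x \<in> X" if "g \<in> carrier G" "x \<in> X" for g x
    using that element_image by blast
  have one: "\<phi> \<one>\<^bsub>G\<^esub> x = x" if "x \<in> X" for x
    using that id_eq_one by (metis restrict_apply')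
  have "group_action G Y \<psi>"
    by (rule group_actionI)
      (use group_hom.axioms(1)[OF group_hom] inv fX closed one composition_rule
        in \<open>auto simp: \<psi>_def\<close>)
  moreover have "finite Y"
    using f fin bij_betw_finite by blast
  moreover have "gset_iso G X \<phi> Y \<psi>"
    unfolding gset_iso_def using f fX by (intro exI[of _ f]) (auto simp: \<psi>_def)
  ultimately show ?thesis
    by (auto simp: finite_gset_def)
qed

lemma gset_class_in_gset_classes:
  assumes "finite_gset G X \<phi>"
  shows "gset_class G X \<phi> \<in> gset_classes G"
proof -
  obtain Y :: "nat set" and \<psi> where "finite_gset G Y \<psi>" "gset_iso G X \<phi> Y \<psi>"
    using finite_gset_nat[OF assms] by blast
  then show ?thesis
    using assms gset_class_cong by (fastforce simp: gset_classes_def finite_gset_def)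
qed

lemma single_gset_class_in_gset_vectors:
  assumes "finite_gset G X \<phi>"
  shows "Poly_Mapping.single (gset_class G X \<phi>) 1 \<in> gset_vectors G"
  using gset_class_in_gset_classes[OF assms] by (simp add: gset_vectors_iff)

section \<open>Additivity of classes over disjoint unions\<close>

lemma finite_gset_sum_action:
  assumes "finite_gset G X \<phi>" "finite_gset G Y \<psi>"
  shows "finite_gset G (X <+> Y) (sum_action X \<phi> Y \<psi>)"
proof -
  interpret X: group_action G X \<phi> using assms by (simp add: finite_gset_def)
  interpret Y: group_action G Y \<psi> using assms by (simp add: finite_gset_def)
  have one: "\<And>x. x \<in> X \<Longrightarrow> \<phi> \<one>\<^bsub>G\<^esub> x = x" "\<And>y. y \<in> Y \<Longrightarrow> \<psi> \<one>\<^bsub>G\<^esub> y = y"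
    using X.id_eq_one Y.id_eq_one by (metis restrict_apply')+
  have closed: "\<And>g x. \<lbrakk>g \<in> carrier G; x \<in> X\<rbrakk> \<Longrightarrow> \<phi> g x \<in> X"
      "\<And>g y. \<lbrakk>g \<in> carrier G; y \<in> Y\<rbrakk> \<Longrightarrow> \<psi> g y \<in> Y"
    using X.element_image Y.element_image by blast+
  have "group_action G (X <+> Y) (sum_action X \<phi> Y \<psi>)"
    by (rule group_actionI)
      (auto simp: group_hom.axioms(1)[OF X.group_hom] sum_action_def one closed
        X.composition_rule Y.composition_rule)
  then show ?thesis
    using assms by (simp add: finite_gset_def)
qed

text \<open>The relations are stated for \<open>G\<close>-sets of natural numbers only, so both summands have to be
  replaced by isomorphic copies.\<close>

lemma single_gset_class_sum:
  assumes X: "finite_gset G X \<phi>" and Y: "finite_gset G Y \<psi>"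
  shows "Poly_Mapping.single (gset_class G (X <+> Y) (sum_action X \<phi> Y \<psi>)) 1
    - Poly_Mapping.single (gset_class G X \<phi>) 1
    - Poly_Mapping.single (gset_class G Y \<psi>) 1 \<in> burnside_ideal G"
proof -
  obtain X' :: "nat set" and \<phi>' where X': "finite_gset G X' \<phi>'" "gset_iso G X \<phi> X' \<phi>'"
    using finite_gset_nat[OF X] by blast
  obtain Y' :: "nat set" and \<psi>' where Y': "finite_gset G Y' \<psi>'" "gset_iso G Y \<psi> Y' \<psi>'"
    using finite_gset_nat[OF Y] by blast
  have actX: "group_action G X \<phi>" and actY: "group_action G Y \<psi>"
    using X Y by (simp_all add: finite_gset_def)
  obtain f where f: "bij_betw f X X'" "\<forall>g\<in>carrier G. \<forall>x\<in>X. f (\<phi> g x) = \<phi>' g (f x)"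
    using X'(2) by (auto simp: gset_iso_def)
  obtain h where h: "bij_betw h Y Y'" "\<forall>g\<in>carrier G. \<forall>x\<in>Y. h (\<psi> g x) = \<psi>' g (h x)"
    using Y'(2) by (auto simp: gset_iso_def)
  have "bij_betw (map_sum f h) (X <+> Y) (X' <+> Y')"
  proof (rule bij_betw_imageI)
    show "inj_on (map_sum f h) (X <+> Y)"
      using f(1) h(1) by (auto simp: bij_betw_def intro!: inj_onI dest: inj_onD)
    have "map_sum f h ` (X <+> Y) = f ` X <+> h ` Y"
      by (simp add: Plus_def image_Un image_image)
    then show "map_sum f h ` (X <+> Y) = X' <+> Y'"
      using f(1) h(1) by (simp add: bij_betw_def)
  qed
  moreover have "map_sum f h (sum_action X \<phi> Y \<psi> g z) = sum_action X' \<phi>' Y' \<psi>' g (map_sum f h z)"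
    if "g \<in> carrier G" "z \<in> X <+> Y" for g z
    using that f h by (auto simp: sum_action_def bij_betwE)
  ultimately have "gset_iso G (X <+> Y) (sum_action X \<phi> Y \<psi>) (X' <+> Y') (sum_action X' \<phi>' Y' \<psi>')"
    by (auto simp: gset_iso_def)
  then have "gset_class G (X <+> Y) (sum_action X \<phi> Y \<psi>) =
      gset_class G (X' <+> Y') (sum_action X' \<phi>' Y' \<psi>')"
    using finite_gset_sum_action[OF X Y] by (intro gset_class_cong) (auto simp: finite_gset_def)
  moreover have "gset_class G X \<phi> = gset_class G X' \<phi>'" "gset_class G Y \<psi> = gset_class G Y' \<psi>'"
    using gset_class_cong[OF actX X'(2)] gset_class_cong[OF actY Y'(2)] by auto
  ultimately show ?thesis
    using X'(1) Y'(1) unfolding burnside_ideal_eq_span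
    by (intro pm.span_base) (auto simp: burnside_relations_def)
qed

text \<open>The disjoint union of an indexed family of G-sets, as a dependent sum.\<close>

definition sigma_action ::
    "'j set \<Rightarrow> ('j \<Rightarrow> 'x set) \<Rightarrow> ('j \<Rightarrow> 'g \<Rightarrow> 'x \<Rightarrow> 'x) \<Rightarrow> 'g \<Rightarrow> 'j \<times> 'x \<Rightarrow> 'j \<times> 'x" where
  "sigma_action J X \<psi> g = (\<lambda>(j, x)\<in>Sigma J X. (j, \<psi> j g x))"

lemma finite_gset_sigma_action:
  assumes "group G" "finite J" "\<And>j. j \<in> J \<Longrightarrow> finite_gset G (X j) (\<psi> j)"
  shows "finite_gset G (Sigma J X) (sigma_action J X \<psi>)"
proof -
  have act: "group_action G (X j) (\<psi> j)" if "j \<in> J" for j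
    using assms(3)[OF that] by (simp add: finite_gset_def)
  have one: "\<psi> j \<one>\<^bsub>G\<^esub> x = x" if "j \<in> J" "x \<in> X j" for j x
    using that group_action.id_eq_one[OF act] by (metis restrict_apply')
  have closed: "\<psi> j g x \<in> X j" if "g \<in> carrier G" "j \<in> J" "x \<in> X j" for g j x
    using that group_action.element_image[OF act] by blast
  have mult: "\<psi> j (g \<otimes>\<^bsub>G\<^esub> h) x = \<psi> j g (\<psi> j h x)"
    if "g \<in> carrier G" "h \<in> carrier G" "j \<in> J" "x \<in> X j" for g h j x
    using that group_action.composition_rule[OF act] by blast
  have "group_action G (Sigma J X) (sigma_action J X \<psi>)"
  proof (rule group_actionI)
    show "group G" by fact
    show "sigma_action J X \<psi> g z \<in> Sigma J X" if "g \<in> carrier G" "z \<in> Sigma J X" for g z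
      using that by (auto simp: closed sigma_action_def)
    show "sigma_action J X \<psi> g \<in> extensional (Sigma J X)" for g
      by (simp add: sigma_action_def)
    show "sigma_action J X \<psi> \<one>\<^bsub>G\<^esub> z = z" if "z \<in> Sigma J X" for z
      using that by (auto simp: sigma_action_def one)
    show "sigma_action J X \<psi> (g \<otimes>\<^bsub>G\<^esub> h) z = sigma_action J X \<psi> g (sigma_action J X \<psi> h z)"
      if "g \<in> carrier G" "h \<in> carrier G" "z \<in> Sigma J X" for g h z
      using that by (auto simp: sigma_action_def closed mult)
  qed
  then show ?thesis
    using assms by (auto simp: finite_gset_def)
qed

lemma single_gset_class_sigma:
  assumes "group G" "finite J" "\<And>j. j \<in> J \<Longrightarrow> finite_gset G (X j) (\<psi> j)"
  shows "Poly_Mapping.single (gset_class G (Sigma J X) (sigma_action J X \<psi>)) 1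
    - (\<Sum>j\<in>J. Poly_Mapping.single (gset_class G (X j) (\<psi> j)) 1) \<in> burnside_ideal G"
  using assms(2,3)
proof (induction J rule: finite_induct)
  case empty
  let ?E = "Sigma {} X" and ?\<phi> = "sigma_action {} X \<psi>"
  have E: "finite_gset G ?E ?\<phi>"
    by (rule finite_gset_sigma_action) (use assms(1) in auto)
  \<comment> \<open>The empty G-set is isomorphic to its sum with itself, so the relation reads [E]
    = [E] + [E] and its class vanishes.\<close>
  have "gset_iso G (?E <+> ?E) (sum_action ?E ?\<phi> ?E ?\<phi>) ?E ?\<phi>"
    by (auto simp: gset_iso_def Plus_def bij_betw_def)
  then have "gset_class G (?E <+> ?E) (sum_action ?E ?\<phi> ?E ?\<phi>) = gset_class G ?E ?\<phi>"
    using finite_gset_sum_action[OF E E] by (intro gset_class_cong) (auto simp: finite_gset_def)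
  with single_gset_class_sum[OF E E] show ?case
    using pm.subspace_neg[OF subspace_burnside_ideal] by fastforce
next
  case (insert j J)
  note I = subspace_burnside_ideal[of G]
  let ?S = "\<lambda>J. Sigma J X" and ?\<phi> = "\<lambda>J. sigma_action J X \<psi>"
  have S: "finite_gset G (?S J) (?\<phi> J)" and Xj: "finite_gset G (X j) (\<psi> j)"
    using insert.hyps insert.prems by (auto intro: finite_gset_sigma_action[OF assms(1)])
  \<comment> \<open>Splits off the summand with index \<open>j\<close>: its points receive that
    index, the other points already carry theirs.\<close>
  let ?f = "case_sum (Pair j) id"
  have "bij_betw ?f (X j <+> ?S J) (?S (insert j J))"
  proof (rule bij_betw_imageI)
    show "inj_on ?f (X j <+> ?S J)"
      using insert.hyps by (auto intro!: inj_onI)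
    show "?f ` (X j <+> ?S J) = ?S (insert j J)"
      by (auto simp: Plus_def image_Un image_image)
  qed
  moreover have "?f (sum_action (X j) (\<psi> j) (?S J) (?\<phi> J) g z) = ?\<phi> (insert j J) g (?f z)"
    if "g \<in> carrier G" "z \<in> X j <+> ?S J" for g z
    using that by (auto simp: sum_action_def sigma_action_def)
  ultimately have "gset_iso G (X j <+> ?S J) (sum_action (X j) (\<psi> j) (?S J) (?\<phi> J))
      (?S (insert j J)) (?\<phi> (insert j J))"
    unfolding gset_iso_def by (intro exI[of _ ?f] conjI ballI)
  then have "gset_class G (?S (insert j J)) (?\<phi> (insert j J)) =
      gset_class G (X j <+> ?S J) (sum_action (X j) (\<psi> j) (?S J) (?\<phi> J))"
    using finite_gset_sum_action[OF Xj S] by (intro gset_class_cong[symmetric]) (auto simp: finite_gset_def)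
  moreover have "Poly_Mapping.single (gset_class G (?S J) (?\<phi> J)) 1
      - (\<Sum>j\<in>J. Poly_Mapping.single (gset_class G (X j) (\<psi> j)) 1) \<in> burnside_ideal G"
    using insert by blast
  ultimately show ?case
    using pm.subspace_add[OF I single_gset_class_sum[OF Xj S]] insert.hyps
    by (fastforce simp: algebra_simps)
qed


section \<open>Counting chains\<close>

definition chains_from :: "('o, 'm, 'z) category_scheme \<Rightarrow> nat \<Rightarrow> 'o \<Rightarrow> 'm list set" where
  "chains_from D n x = {ms. length ms = n \<and> nondegenerate_chain D x ms}"

lemma set_nondegenerate_chain: "nondegenerate_chain D x ms \<Longrightarrow> set ms \<subseteq> mor D"
  by (induction ms arbitrary: x) auto

lemma finite_chains_from:
  assumes "finite (mor D)"
  shows "finite (chains_from D n x)"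
proof (rule finite_subset)
  show "chains_from D n x \<subseteq> {ms. set ms \<subseteq> mor D \<and> length ms = n}"
    using set_nondegenerate_chain by (fastforce simp: chains_from_def)
  show "finite {ms. set ms \<subseteq> mor D \<and> length ms = n}"
    using assms by (rule finite_lists_length_eq)
qed

text \<open>Chains are sorted by their first morphism, whose target starts the rest of the
  chain.\<close>

lemma card_chains_from_Suc:
  assumes "finite (mor D)"
  shows "card (chains_from D (Suc n) x) =
    (\<Sum>m | m \<in> mor D \<and> src D m = x \<and> m \<notin> ident D ` obj D. card (chains_from D n (trg D m)))"
proof -
  let ?M = "{m. m \<in> mor D \<and> src D m = x \<and> m \<notin> ident D ` obj D}"
  have "chains_from D (Suc n) x = (\<Union>m\<in>?M. Cons m ` chains_from D n (trg D m))"
    by (auto simp: chains_from_def length_Suc_conv)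
  also have "card \<dots> = (\<Sum>m\<in>?M. card (Cons m ` chains_from D n (trg D m)))"
    using assms finite_chains_from[OF assms] by (intro card_UN_disjoint) auto
  also have "\<dots> = (\<Sum>m\<in>?M. card (chains_from D n (trg D m)))"
    by (simp add: card_image)
  finally show ?thesis .
qed


section \<open>Cosets and their stabilizers\<close>

locale subgroup_collection = group G for G :: "('g, 'b) monoid_scheme" (structure) +
  fixes \<C> :: "'g set set"
  assumes finite_carrier: "finite (carrier G)"
    and subgroups: "H \<in> \<C> \<Longrightarrow> subgroup H G"
    and conjugates: "\<lbrakk>H \<in> \<C>; g \<in> carrier G\<rbrakk> \<Longrightarrow> g <#\<^bsub>G\<^esub> H #> inv g \<in> \<C>"
begin

lemma subgroup_subset: "H \<in> \<C> \<Longrightarrow> H \<subseteq> carrier G"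
  by (rule subgroup.subset[OF subgroups])

lemma finite_collection: "finite \<C>"
  by (rule finite_subset[of _ "Pow (carrier G)"]) (use subgroup_subset finite_carrier in auto)

lemma finite_lcosets: "finite (lcosets H)"
  using finite_carrier by (simp add: LCOSETS_def)

lemma lcosetsE:
  assumes "b \<in> lcosets H"
  obtains g where "g \<in> carrier G" "b = g <#\<^bsub>G\<^esub> H"
  using assms by (auto simp: LCOSETS_def)

lemma lcosetsI: "g \<in> carrier G \<Longrightarrow> g <#\<^bsub>G\<^esub> H \<in> lcosets H"
  by (auto simp: LCOSETS_def)

lemma self_in_lcosets: "H \<in> \<C> \<Longrightarrow> H \<in> lcosets H"
  using lcosetsI[of \<one> H] subgroup_subset by (simp add: lcos_mult_one)

lemma lcoset_subset: "\<lbrakk>H \<in> \<C>; b \<in> lcosets H\<rbrakk> \<Longrightarrow> b \<subseteq> carrier G"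
  by (meson subgroup.lcosets_carrier subgroups is_group)

lemma translate_translate:
  "\<lbrakk>H \<in> \<C>; b \<in> lcosets H; g \<in> carrier G; h \<in> carrier G\<rbrakk> \<Longrightarrow> g <#\<^bsub>G\<^esub> (h <#\<^bsub>G\<^esub> b) = (g \<otimes> h) <#\<^bsub>G\<^esub> b"
  by (rule lcos_m_assoc[OF lcoset_subset])

lemma translate_in_lcosets: "\<lbrakk>H \<in> \<C>; b \<in> lcosets H; g \<in> carrier G\<rbrakk> \<Longrightarrow> g <#\<^bsub>G\<^esub> b \<in> lcosets H"
  by (auto elim!: lcosetsE simp: lcos_m_assoc[OF subgroup_subset] intro!: lcosetsI)

lemma translate_one: "\<lbrakk>H \<in> \<C>; b \<in> lcosets H\<rbrakk> \<Longrightarrow> \<one> <#\<^bsub>G\<^esub> b = b"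
  by (rule lcos_mult_one[OF lcoset_subset])

lemma lcosets_transitive:
  assumes "H \<in> \<C>" "a \<in> lcosets H" "b \<in> lcosets H"
  obtains g where "g \<in> carrier G" "g <#\<^bsub>G\<^esub> a = b"
proof -
  obtain x y where xy: "x \<in> carrier G" "a = x <#\<^bsub>G\<^esub> H" "y \<in> carrier G" "b = y <#\<^bsub>G\<^esub> H"
    using assms by (auto elim!: lcosetsE)
  then have "y \<otimes> inv x \<otimes> x = y"
    by (simp add: m_assoc)
  then have "(y \<otimes> inv x) <#\<^bsub>G\<^esub> a = b"
    using xy by (simp add: lcos_m_assoc[OF subgroup_subset[OF assms(1)]])
  with xy show ?thesis
    by (intro that[of "y \<otimes> inv x"]) simp_all
qed

lemma coset_action_eq: "b \<in> lcosets H \<Longrightarrow> coset_action G H g b = g <#\<^bsub>G\<^esub> b"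
  by (simp add: coset_action_def)

section \<open>Stabilizers of cosets\<close>

definition coset_stabilizer :: "'g set \<Rightarrow> 'g set" where
  "coset_stabilizer b = {g \<in> carrier G. g <#\<^bsub>G\<^esub> b = b}"

text \<open>For x in G, membership in either side says that xg lies in gH.\<close>

lemma coset_stabilizer_lcoset:
  assumes H: "H \<in> \<C>" and g: "g \<in> carrier G"
  shows "coset_stabilizer (g <#\<^bsub>G\<^esub> H) = g <#\<^bsub>G\<^esub> H #> inv g"
proof -
  note sub = subgroup_subset[OF H]
  have "x \<in> coset_stabilizer (g <#\<^bsub>G\<^esub> H) \<longleftrightarrow> x \<otimes> g \<in> g <#\<^bsub>G\<^esub> H" if x: "x \<in> carrier G" for x
  proof -
    have "x <#\<^bsub>G\<^esub> (g <#\<^bsub>G\<^esub> H) = g <#\<^bsub>G\<^esub> H \<longleftrightarrow> x \<otimes> g \<in> g <#\<^bsub>G\<^esub> H"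
      using lcos_self[OF _ subgroups[OF H], of "x \<otimes> g"]
        l_repr_independence[OF _ g subgroups[OF H], of "x \<otimes> g"] x g
      by (auto simp: lcos_m_assoc[OF sub])
    with x show ?thesis
      by (simp add: coset_stabilizer_def)
  qed
  moreover have "x \<in> g <#\<^bsub>G\<^esub> H #> inv g \<longleftrightarrow> x \<otimes> g \<in> g <#\<^bsub>G\<^esub> H" if x: "x \<in> carrier G" for x
  proof
    assume "x \<in> g <#\<^bsub>G\<^esub> H #> inv g"
    then obtain y where "y \<in> g <#\<^bsub>G\<^esub> H" "x = y \<otimes> inv g"
      by (auto simp: r_coset_def)
    then show "x \<otimes> g \<in> g <#\<^bsub>G\<^esub> H"
      using g l_coset_subset_G[OF sub g] by (auto simp: m_assoc)
  next
    assume "x \<otimes> g \<in> g <#\<^bsub>G\<^esub> H"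
    moreover have "x = (x \<otimes> g) \<otimes> inv g"
      using x g by (simp add: m_assoc)
    ultimately show "x \<in> g <#\<^bsub>G\<^esub> H #> inv g"
      by (auto simp: r_coset_def)
  qed
  moreover have "g <#\<^bsub>G\<^esub> H #> inv g \<subseteq> carrier G"
    using g sub by (simp add: l_coset_subset_G r_coset_subset_G)
  ultimately show ?thesis
    by (auto simp: coset_stabilizer_def)
qed

text \<open>Closure under conjugation enters here: stabilizers of objects stay in \<C>, so they can
  index the count of chains.\<close>

lemma coset_stabilizer_in_collection:
  "\<lbrakk>H \<in> \<C>; b \<in> lcosets H\<rbrakk> \<Longrightarrow> coset_stabilizer b \<in> \<C>"
  using conjugates coset_stabilizer_lcoset by (metis lcosetsE)

lemma coset_stabilizer_self: "H \<in> \<C> \<Longrightarrow> coset_stabilizer H = H"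
  using coset_stabilizer_lcoset[of H \<one>] subgroup_subset by (simp add: lcos_mult_one)

lemma mem_E_orbit_category_obj:
  "(H, b) \<in> E_orbit_category_obj G \<C> \<longleftrightarrow> H \<in> \<C> \<and> b \<in> lcosets H"
  by (simp add: E_orbit_category_obj_def orbit_category_def)

text \<open>If gH = hK then also gH = gK, and translating back by the inverse of g gives H = K. So
  an object (H, b) is determined by b.\<close>

lemma lcoset_subgroup_unique:
  assumes "H \<in> \<C>" "K \<in> \<C>" "b \<in> lcosets H" "b \<in> lcosets K"
  shows "H = K"
proof -
  obtain g where g: "g \<in> carrier G" "b = g <#\<^bsub>G\<^esub> H"
    using assms by (auto elim: lcosetsE)
  obtain h where h: "h \<in> carrier G" "b = h <#\<^bsub>G\<^esub> K"
    using assms by (auto elim: lcosetsE)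
  have "g \<in> h <#\<^bsub>G\<^esub> K"
    using lcos_self[OF g(1) subgroups[OF assms(1)]] g h by simp
  then have "g <#\<^bsub>G\<^esub> H = g <#\<^bsub>G\<^esub> K"
    using l_repr_independence[OF _ h(1) subgroups[OF assms(2)]] g h by simp
  then have "inv g <#\<^bsub>G\<^esub> (g <#\<^bsub>G\<^esub> H) = inv g <#\<^bsub>G\<^esub> (g <#\<^bsub>G\<^esub> K)"
    by simp
  then show ?thesis
    using g assms subgroup_subset by (simp add: lcos_m_assoc lcos_mult_one)
qed

text \<open>A left coset \<open>gK\<close> with stabilizer \<open>L = gKg\<^sup>-\<^sup>1\<close> is the right coset \<open>Lg\<close>.\<close>

lemma pointed_orbits_with_stabilizer:
  assumes L: "L \<in> \<C>"
  shows "bij_betw snd {y \<in> E_orbit_category_obj G \<C>. coset_stabilizer (snd y) = L} (rcosets L)"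
proof (rule bij_betw_imageI)
  show "inj_on snd {y \<in> E_orbit_category_obj G \<C>. coset_stabilizer (snd y) = L}"
    using lcoset_subgroup_unique by (fastforce intro!: inj_onI simp: mem_E_orbit_category_obj)
  have "b \<in> rcosets L" if "H \<in> \<C>" "b \<in> lcosets H" "coset_stabilizer b = L" for H b
  proof -
    obtain g where g: "g \<in> carrier G" "b = g <#\<^bsub>G\<^esub> H"
      using lcosetsE[OF \<open>b \<in> lcosets H\<close>] by blast
    have "L = g <#\<^bsub>G\<^esub> H #> inv g"
      using that g coset_stabilizer_lcoset by simp
    then have "L #> g = b"
      using that g subgroup_subset by (simp add: coset_mult_assoc l_coset_subset_G)
    then show ?thesis
      using rcosetsI[OF subgroup_subset[OF L] g(1)] by simp
  qed
  moreover have "\<exists>H. H \<in> \<C> \<and> b \<in> lcosets H \<and> coset_stabilizer b = L" if "b \<in> rcosets L" for b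
  proof -
    obtain g where g: "g \<in> carrier G" "b = L #> g"
      using \<open>b \<in> rcosets L\<close> unfolding RCOSETS_def by blast
    \<comment> \<open>The conjugate of \<open>L\<close> whose left coset by \<open>g\<close> is
      \<open>L #> g\<close>; closure under conjugation puts it in \<C>.\<close>
    let ?H = "inv g <#\<^bsub>G\<^esub> L #> g"
    have H: "?H \<in> \<C>"
      using conjugates[OF L, of "inv g"] g by simp
    have b: "b = g <#\<^bsub>G\<^esub> ?H"
      using g L subgroup_subset
      by (simp add: lcos_m_assoc lcos_mult_one r_coset_subset_G flip: coset_assoc)
    then have "coset_stabilizer b = b #> inv g"
      using coset_stabilizer_lcoset[OF H g(1)] by simp
    also have "\<dots> = L"
      using g L subgroup_subset by (simp add: coset_mult_assoc)
    finally have "coset_stabilizer b = L" .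
    moreover have "b \<in> lcosets ?H"
      by (subst b) (rule lcosetsI[OF g(1)])
    ultimately show ?thesis
      using H by blast
  qed
  ultimately show "snd ` {y \<in> E_orbit_category_obj G \<C>. coset_stabilizer (snd y) = L} = rcosets L"
    by (force simp: mem_E_orbit_category_obj image_iff)
qed

lemma card_lcosets_pos: "H \<in> \<C> \<Longrightarrow> card (lcosets H) > 0"
  using self_in_lcosets finite_lcosets card_gt_0_iff by blast

text \<open>The bijection counts right cosets; the two forms of Lagrange's theorem give equally many
  left cosets.\<close>

lemma card_pointed_orbits_with_stabilizer:
  assumes L: "L \<in> \<C>"
  shows "card {y \<in> E_orbit_category_obj G \<C>. coset_stabilizer (snd y) = L} = card (lcosets L)"
proof -
  have "card (rcosets L) * card L = card (lcosets L) * card L"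
    using lagrange[OF subgroups[OF L]] l_lagrange[OF finite_carrier subgroups[OF L]] by simp
  moreover have "card L > 0"
    using subgroup.finite_imp_card_positive[OF subgroups[OF L] finite_carrier] .
  ultimately show ?thesis
    using bij_betw_same_card[OF pointed_orbits_with_stabilizer[OF L]] by simp
qed


section \<open>Maps between orbits\<close>

lemma coset_gmap_closed: "\<lbrakk>\<phi> \<in> coset_gmaps G H K; a \<in> lcosets H\<rbrakk> \<Longrightarrow> \<phi> a \<in> lcosets K"
  by (auto simp: coset_gmaps_def)

lemma coset_gmap_translate:
  "\<lbrakk>\<phi> \<in> coset_gmaps G H K; a \<in> lcosets H; g \<in> carrier G\<rbrakk> \<Longrightarrow> \<phi> (g <#\<^bsub>G\<^esub> a) = g <#\<^bsub>G\<^esub> \<phi> a"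
  using coset_gmap_closed by (fastforce simp: coset_gmaps_def coset_action_eq)

text \<open>G acts transitively on G/H, so one value determines an equivariant map.\<close>

lemma coset_gmap_unique:
  assumes "H \<in> \<C>" "\<phi> \<in> coset_gmaps G H K" "\<psi> \<in> coset_gmaps G H K" "a \<in> lcosets H" "\<phi> a = \<psi> a"
  shows "\<phi> = \<psi>"
proof (rule extensionalityI)
  show "\<phi> \<in> extensional (lcosets H)" "\<psi> \<in> extensional (lcosets H)"
    using assms by (auto simp: coset_gmaps_def PiE_def)
  fix b assume "b \<in> lcosets H"
  then obtain g where "g \<in> carrier G" "g <#\<^bsub>G\<^esub> a = b"
    using lcosets_transitive[OF assms(1,4)] by blast
  then show "\<phi> b = \<psi> b"
    using assms coset_gmap_translate by metis
qed

lemma coset_gmap_stabilizer: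
  "\<lbrakk>\<phi> \<in> coset_gmaps G H K; a \<in> lcosets H\<rbrakk> \<Longrightarrow> coset_stabilizer a \<subseteq> coset_stabilizer (\<phi> a)"
  using coset_gmap_translate by (fastforce simp: coset_stabilizer_def)

text \<open>The map sends ga to gb, which is well defined because whatever fixes a fixes b.\<close>

lemma coset_gmap_exists:
  assumes H: "H \<in> \<C>" and K: "K \<in> \<C>" and a: "a \<in> lcosets H" and b: "b \<in> lcosets K"
    and stab: "coset_stabilizer a \<subseteq> coset_stabilizer b"
  shows "\<exists>\<phi>\<in>coset_gmaps G H K. \<phi> a = b"
proof -
  have wd: "g <#\<^bsub>G\<^esub> b = h <#\<^bsub>G\<^esub> b" if "g \<in> carrier G" "h \<in> carrier G" "g <#\<^bsub>G\<^esub> a = h <#\<^bsub>G\<^esub> a" for g h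
  proof -
    have "(inv h \<otimes> g) <#\<^bsub>G\<^esub> a = inv h <#\<^bsub>G\<^esub> (h <#\<^bsub>G\<^esub> a)"
      using that by (simp flip: translate_translate[OF H a])
    also have "\<dots> = a"
      using that by (simp add: translate_translate[OF H a] translate_one[OF H a])
    finally have "inv h \<otimes> g \<in> coset_stabilizer a"
      using that by (simp add: coset_stabilizer_def)
    then have "(inv h \<otimes> g) <#\<^bsub>G\<^esub> b = b"
      using stab by (auto simp: coset_stabilizer_def)
    then have "h <#\<^bsub>G\<^esub> ((inv h \<otimes> g) <#\<^bsub>G\<^esub> b) = h <#\<^bsub>G\<^esub> b"
      by simp
    then show ?thesis
      using that by (simp add: translate_translate[OF K b] flip: m_assoc)
  qed
  define \<phi> where "\<phi> = (\<lambda>c\<in>lcosets H. (SOME g. g \<in> carrier G \<and> g <#\<^bsub>G\<^esub> a = c) <#\<^bsub>G\<^esub> b)"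
  have \<phi>: "\<phi> (g <#\<^bsub>G\<^esub> a) = g <#\<^bsub>G\<^esub> b" if g: "g \<in> carrier G" for g
  proof -
    define k where "k = (SOME h. h \<in> carrier G \<and> h <#\<^bsub>G\<^esub> a = g <#\<^bsub>G\<^esub> a)"
    have "k \<in> carrier G \<and> k <#\<^bsub>G\<^esub> a = g <#\<^bsub>G\<^esub> a"
      unfolding k_def using g by (intro someI_ex[of "\<lambda>h. h \<in> carrier G \<and> h <#\<^bsub>G\<^esub> a = g <#\<^bsub>G\<^esub> a"]) blast
    then have "k <#\<^bsub>G\<^esub> b = g <#\<^bsub>G\<^esub> b"
      using wd g by blast
    then show ?thesis
      using translate_in_lcosets[OF H a g] by (simp add: \<phi>_def flip: k_def)
  qed
  have "\<phi> \<in> coset_gmaps G H K"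
    unfolding coset_gmaps_def
  proof (intro CollectI conjI ballI PiE_I)
    fix c assume c: "c \<in> lcosets H"
    then obtain g where g: "g \<in> carrier G" "g <#\<^bsub>G\<^esub> a = c"
      using lcosets_transitive[OF H a] by blast
    then show "\<phi> c \<in> lcosets K"
      using \<phi> translate_in_lcosets[OF K b] by auto
    fix h assume h: "h \<in> carrier G"
    have "\<phi> (h <#\<^bsub>G\<^esub> c) = h <#\<^bsub>G\<^esub> \<phi> c"
      using g h \<phi>[of "h \<otimes> g"] \<phi>[of g] translate_translate[OF H a] translate_translate[OF K b] by auto
    then show "\<phi> (coset_action G H h c) = coset_action G K h (\<phi> c)"
      using c \<open>\<phi> c \<in> lcosets K\<close> by (simp add: coset_action_eq)
  qed (simp add: \<phi>_def)
  moreover have "\<phi> a = b"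
    using \<phi>[of \<one>] by (simp add: translate_one[OF H a] translate_one[OF K b])
  ultimately show ?thesis
    by blast
qed

section \<open>Morphisms and chains from an object of the Grothendieck construction\<close>

abbreviation \<O> where "\<O> \<equiv> orbit_category G \<C>"
abbreviation E\<O> where "E\<O> \<equiv> E_orbit_category G \<C>"

lemma finite_mor_E_orbit_category: "finite (mor E\<O>)"
proof -
  have "finite_gcategory G E\<O>"
    by (rule finite_gcategory_E_orbit_category) (use is_group finite_carrier subgroups in auto)
  then show ?thesis
    by (simp add: finite_gcategory_def finite_category_def)
qed

lemmas orbit_category_simps = orbit_category_def E_orbit_category_def E_orbit_category_obj_def
  E_orbit_category_mor_def

lemma id_coset_gmap: "H \<in> \<C> \<Longrightarrow> (\<lambda>c\<in>lcosets H. c) \<in> coset_gmaps G H H"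
  by (auto simp: coset_gmaps_def coset_action_eq translate_in_lcosets)

lemma mor_E_orbit_category_from:
  "m \<in> mor E\<O> \<and> src E\<O> m = (H, a) \<longleftrightarrow> (\<exists>\<phi> K. m = ((H, a), \<phi>, (K, \<phi> a)) \<and>
    H \<in> \<C> \<and> a \<in> lcosets H \<and> K \<in> \<C> \<and> \<phi> \<in> coset_gmaps G H K)"
  by (auto simp: orbit_category_simps)

text \<open>Between two objects there is at most one morphism, so morphisms are recorded by their
  targets. Excluding identities excludes \<open>x\<close> alone: other objects with the same
  stabilizer are isomorphic to \<open>x\<close> but remain admissible targets.\<close>

lemma E_orbit_category_mor_from:
  assumes x: "x \<in> obj E\<O>"
  shows "bij_betw (trg E\<O>) {m. m \<in> mor E\<O> \<and> src E\<O> m = x \<and> m \<notin> ident E\<O> ` obj E\<O>}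
    {y \<in> obj E\<O>. coset_stabilizer (snd x) \<subseteq> coset_stabilizer (snd y) \<and> y \<noteq> x}"
    (is "bij_betw _ ?M ?Y")
proof -
  obtain H a where xH: "x = (H, a)" "H \<in> \<C>" "a \<in> lcosets H"
    using x by (auto simp: orbit_category_simps)
  \<comment> \<open>An arrow returning to (H, a) fixes the point \<open>a\<close>, as the identity
    does, so uniqueness makes it the identity.\<close>
  have ident_iff: "((H, a), \<phi>, (K, \<phi> a)) \<in> ident E\<O> ` obj E\<O> \<longleftrightarrow> (K, \<phi> a) = (H, a)"
    if "\<phi> \<in> coset_gmaps G H K" for \<phi> K
  proof
    assume "(K, \<phi> a) = (H, a)"
    moreover from this have "\<phi> = (\<lambda>c\<in>lcosets H. c)"
      using that xH coset_gmap_unique[OF xH(2) _ id_coset_gmap[OF xH(2)] xH(3)] by auto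
    ultimately have "((H, a), \<phi>, (K, \<phi> a)) = ident E\<O> (H, a)"
      using xH by (simp add: E_orbit_category_def)
    then show "((H, a), \<phi>, (K, \<phi> a)) \<in> ident E\<O> ` obj E\<O>"
      using x unfolding xH(1) by (rule image_eqI)
  qed (auto simp: E_orbit_category_def)
  have M: "m \<in> ?M \<longleftrightarrow> (\<exists>\<phi> K. m = ((H, a), \<phi>, (K, \<phi> a)) \<and> K \<in> \<C> \<and> \<phi> \<in> coset_gmaps G H K \<and>
      (K, \<phi> a) \<noteq> x)" for m
  proof -
    have "m \<in> ?M \<longleftrightarrow> (m \<in> mor E\<O> \<and> src E\<O> m = (H, a)) \<and> m \<notin> ident E\<O> ` obj E\<O>"
      by (simp add: xH(1))
    also have "\<dots> \<longleftrightarrow> (\<exists>\<phi> K. (m = ((H, a), \<phi>, (K, \<phi> a)) \<and> K \<in> \<C> \<and> \<phi> \<in> coset_gmaps G H K) \<and>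
        m \<notin> ident E\<O> ` obj E\<O>)"
      unfolding mor_E_orbit_category_from using xH(2,3) by blast
    also have "\<dots> \<longleftrightarrow> (\<exists>\<phi> K. m = ((H, a), \<phi>, (K, \<phi> a)) \<and> K \<in> \<C> \<and>
        \<phi> \<in> coset_gmaps G H K \<and> (K, \<phi> a) \<noteq> x)"
      unfolding xH(1) using ident_iff by (intro iff_exI) auto
    finally show ?thesis .
  qed
  show ?thesis
  proof (rule bij_betw_imageI)
    show "inj_on (trg E\<O>) ?M"
    proof (rule inj_onI)
      fix m n assume "m \<in> ?M" "n \<in> ?M" and trg: "trg E\<O> m = trg E\<O> n"
      then obtain \<phi> K \<psi> L where "m = ((H, a), \<phi>, (K, \<phi> a))" "\<phi> \<in> coset_gmaps G H K"
          "n = ((H, a), \<psi>, (L, \<psi> a))" "\<psi> \<in> coset_gmaps G H L"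
        unfolding M by blast
      with trg show "m = n"
        using coset_gmap_unique[OF xH(2) _ _ xH(3), of \<phi> K \<psi>] by (simp add: E_orbit_category_def)
    qed
    show "trg E\<O> ` ?M = ?Y"
    proof (intro subset_antisym subsetI)
      fix y assume "y \<in> trg E\<O> ` ?M"
      then obtain m where m: "m \<in> ?M" "y = trg E\<O> m"
        by blast
      from m(1) obtain \<phi> K where "m = ((H, a), \<phi>, (K, \<phi> a))" "K \<in> \<C>"
          "\<phi> \<in> coset_gmaps G H K" "(K, \<phi> a) \<noteq> x"
        unfolding M by blast
      moreover from this have "y = (K, \<phi> a)"
        by (simp add: m(2) E_orbit_category_def)
      ultimately have "y = (K, \<phi> a)" "K \<in> \<C>" "\<phi> \<in> coset_gmaps G H K" "(K, \<phi> a) \<noteq> x"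
        by blast+
      then show "y \<in> ?Y"
        using xH coset_gmap_closed coset_gmap_stabilizer
        by (auto simp: E_orbit_category_def mem_E_orbit_category_obj)
    next
      fix y assume y: "y \<in> ?Y"
      then obtain K b where K: "y = (K, b)" "K \<in> \<C>" "b \<in> lcosets K"
        by (auto simp: orbit_category_simps)
      then obtain \<phi> where \<phi>: "\<phi> \<in> coset_gmaps G H K" "\<phi> a = b"
        using coset_gmap_exists[OF xH(2) K(2) xH(3) K(3)] y xH by auto
      then have "((H, a), \<phi>, (K, b)) \<in> ?M"
        unfolding M using K y by blast
      then show "y \<in> trg E\<O> ` ?M"
        by (rule rev_image_eqI) (simp add: K E_orbit_category_def)
    qed
  qed
qed

text \<open>The coefficients c_n(L) for a start with stabilizer \<open>L\<close>. The sum runs over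
  all morphisms, with |G : M| targets of stabilizer \<open>M\<close>; the subtracted term removes
  the identity, which sits in the part \<open>M = L\<close>. Values are rational so that the
  subtraction is not truncated.\<close>

primrec chain_count :: "nat \<Rightarrow> 'g set \<Rightarrow> rat" where
  "chain_count 0 L = 1"
| "chain_count (Suc n) L =
     (\<Sum>M | M \<in> \<C> \<and> L \<subseteq> M. of_nat (card (lcosets M)) * chain_count n M) - chain_count n L"

text \<open>Only the stabilizer of the start matters: targets are grouped by stabilizer, and each
  \<open>L\<close> in \<C> containing that of the start belongs to |G : L| objects.\<close>

lemma card_chains_from_E_orbit_category:
  "x \<in> obj E\<O> \<Longrightarrow> of_nat (card (chains_from E\<O> n x)) = chain_count n (coset_stabilizer (snd x))"
proof (induction n arbitrary: x)
  case 0
  then have "chains_from E\<O> 0 x = {[]}"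
    by (auto simp: chains_from_def)
  then show ?case
    by simp
next
  case (Suc n)
  let ?s = "\<lambda>y :: 'g pointed_orbit. coset_stabilizer (snd y)"
  let ?M = "{m. m \<in> mor E\<O> \<and> src E\<O> m = x \<and> m \<notin> ident E\<O> ` obj E\<O>}"
  let ?Y = "{y \<in> obj E\<O>. ?s x \<subseteq> ?s y}"
  have fin: "finite (obj E\<O>)"
  proof -
    have "obj E\<O> \<subseteq> \<C> \<times> (\<Union>H\<in>\<C>. lcosets H)"
      by (auto simp: orbit_category_simps)
    then show ?thesis
      by (rule finite_subset) (use finite_collection finite_lcosets in auto)
  qed
  have M: "bij_betw (trg E\<O>) ?M (?Y - {x})"
    using E_orbit_category_mor_from[OF Suc.prems] by (simp add: set_diff_eq conj_assoc)
  have stab: "?s y \<in> \<C>" if "y \<in> obj E\<O>" for y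
    using that coset_stabilizer_in_collection by (auto simp: orbit_category_simps)
  have "of_nat (card (chains_from E\<O> (Suc n) x)) =
      (\<Sum>m\<in>?M. of_nat (card (chains_from E\<O> n (trg E\<O> m))) :: rat)"
    by (simp add: card_chains_from_Suc[OF finite_mor_E_orbit_category])
  also have "\<dots> = (\<Sum>y\<in>?Y - {x}. of_nat (card (chains_from E\<O> n y)))"
    by (rule sum.reindex_bij_betw[OF M])
  also have "\<dots> = (\<Sum>y\<in>?Y - {x}. chain_count n (?s y))"
    by (intro sum.cong) (auto simp: Suc.IH)
  \<comment> \<open>\<open>x\<close> itself belongs to \<open>?Y\<close>; its term is the
    contribution of the identity.\<close>
  also have "\<dots> = (\<Sum>y\<in>?Y. chain_count n (?s y)) - chain_count n (?s x)"
    using Suc.prems fin by (subst sum_diff1) auto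
  also have "(\<Sum>y\<in>?Y. chain_count n (?s y)) =
      (\<Sum>L | L \<in> \<C> \<and> ?s x \<subseteq> L. \<Sum>y | y \<in> ?Y \<and> ?s y = L. chain_count n (?s y))"
    using fin finite_collection stab by (intro sum.group[symmetric]) auto
  also have "\<dots> = (\<Sum>L | L \<in> \<C> \<and> ?s x \<subseteq> L. of_nat (card (lcosets L)) * chain_count n L)"
  proof (intro sum.cong refl)
    fix L assume L: "L \<in> {L. L \<in> \<C> \<and> ?s x \<subseteq> L}"
    then have "{y. y \<in> ?Y \<and> ?s y = L} = {y \<in> E_orbit_category_obj G \<C>. ?s y = L}"
      by (auto simp: E_orbit_category_def)
    then show "(\<Sum>y | y \<in> ?Y \<and> ?s y = L. chain_count n (?s y)) =
        of_nat (card (lcosets L)) * chain_count n L"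
      using L by (simp add: card_pointed_orbits_with_stabilizer)
  qed
  finally show ?case
    by simp
qed


section \<open>Simplices as lifted chains\<close>

text \<open>The lift of a chain of the orbit category that starts at the point \<open>a\<close>:
  each map carries the current point to the next one.\<close>

fun lift_chain ::
    "'g set \<Rightarrow> ('g set \<times> ('g set \<Rightarrow> 'g set) \<times> 'g set) list
      \<Rightarrow> ('g pointed_orbit \<times> ('g set \<Rightarrow> 'g set) \<times> 'g pointed_orbit) list" where
  "lift_chain a [] = []"
| "lift_chain a ((H, \<phi>, K) # ms) = ((H, a), \<phi>, (K, \<phi> a)) # lift_chain (\<phi> a) ms"

lemma length_lift_chain [simp]: "length (lift_chain a ms) = length ms"
  by (induction a ms rule: lift_chain.induct) auto

text \<open>Forgetting the points recovers the original chain.\<close>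

lemma inj_lift_chain: "inj (lift_chain a)"
proof (rule injI)
  let ?proj = "\<lambda>((H, a), \<phi>, (K, b)). (H, \<phi>, K)"
  have proj: "map ?proj (lift_chain a ms) = ms" for ms
    by (induction a ms rule: lift_chain.induct) auto
  show "ms = ns" if "lift_chain a ms = lift_chain a ns" for ms ns
    using that proj by metis
qed

lemma nondegenerate_chain_lift_chain:
  assumes "nondegenerate_chain \<O> H ms" "a \<in> lcosets H"
  shows "nondegenerate_chain E\<O> (H, a) (lift_chain a ms)"
  using assms
proof (induction a ms arbitrary: H rule: lift_chain.induct)
  case (1 a)
  then show ?case
    by (simp add: orbit_category_simps)
next
  case (2 a H' \<phi> K ms)
  then have m: "H' = H" "H \<in> \<C>" "K \<in> \<C>" "\<phi> \<in> coset_gmaps G H K"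
      "(H, \<phi>, K) \<notin> ident \<O> ` \<C>" and ms: "nondegenerate_chain \<O> K ms"
    by (auto simp: orbit_category_def)
  have "((H, a), \<phi>, (K, \<phi> a)) \<notin> ident E\<O> ` obj E\<O>"
    using m(2,5) by (auto simp: orbit_category_simps image_iff)
  moreover have "nondegenerate_chain E\<O> (K, \<phi> a) (lift_chain (\<phi> a) ms)"
    using "2.IH"[OF ms] coset_gmap_closed[OF m(4)] "2.prems" by blast
  ultimately show ?case
    using m "2.prems" by (auto simp: orbit_category_simps)
qed

text \<open>A morphism of \<open>E\<O>\<close> is an orbit category morphism with a point of its
  source, so morphisms can be peeled off one at a time. Non-degeneracy descends because an identity
  of \<open>\<O>\<close> together with a point is an identity of \<open>E\<O>\<close>.\<close>

lemma nondegenerate_chain_is_lift_chain: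
  assumes "nondegenerate_chain E\<O> (H, a) ms"
  shows "H \<in> \<C> \<and> a \<in> lcosets H \<and> (\<exists>ns. nondegenerate_chain \<O> H ns \<and> ms = lift_chain a ns)"
  using assms
proof (induction ms arbitrary: H a)
  case Nil
  then show ?case
    by (intro conjI exI[of _ "[]"]) (auto simp: orbit_category_simps)
next
  case (Cons m ms)
  then have "m \<in> mor E\<O> \<and> src E\<O> m = (H, a)"
    by simp
  then obtain \<phi> K where m: "m = ((H, a), \<phi>, (K, \<phi> a))" and H: "H \<in> \<C>" "a \<in> lcosets H"
    and K: "K \<in> \<C>" and \<phi>: "\<phi> \<in> coset_gmaps G H K"
    unfolding mor_E_orbit_category_from by blast
  have "nondegenerate_chain E\<O> (K, \<phi> a) ms"
    using Cons.prems by (simp add: m E_orbit_category_def)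
  then obtain ns where ns: "nondegenerate_chain \<O> K ns" "ms = lift_chain (\<phi> a) ns"
    using Cons.IH by blast
  have "(H, \<phi>, K) \<notin> ident \<O> ` \<C>"
  proof
    assume "(H, \<phi>, K) \<in> ident \<O> ` \<C>"
    then have "m = ident E\<O> (H, a)"
      using H by (auto simp: m orbit_category_simps)
    moreover have "(H, a) \<in> obj E\<O>"
      using H by (simp add: orbit_category_simps)
    ultimately show False
      using Cons.prems by auto
  qed
  then have "nondegenerate_chain \<O> H ((H, \<phi>, K) # ns)"
    using H K \<phi> ns(1) by (simp add: orbit_category_def)
  moreover have "m # ms = lift_chain a ((H, \<phi>, K) # ns)"
    by (simp add: m ns(2))
  ultimately show ?case
    using H by blast
qed

lemma bij_betw_lift_chain:
  assumes "a \<in> lcosets H"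
  shows "bij_betw (lift_chain a) (chains_from \<O> n H) (chains_from E\<O> n (H, a))"
proof (rule bij_betw_imageI)
  show "inj_on (lift_chain a) (chains_from \<O> n H)"
    using inj_lift_chain by (rule inj_on_subset) simp
  show "lift_chain a ` chains_from \<O> n H = chains_from E\<O> n (H, a)"
    using nondegenerate_chain_lift_chain[OF _ assms] nondegenerate_chain_is_lift_chain
    by (fastforce simp: chains_from_def image_iff)
qed

text \<open>Chains are lifted at the coset \<open>H\<close> itself, whose stabilizer is
  \<open>H\<close>.\<close>

lemma card_chains_from_orbit_category:
  assumes "H \<in> \<C>"
  shows "of_nat (card (chains_from \<O> n H)) = chain_count n H"
  using bij_betw_same_card[OF bij_betw_lift_chain[OF self_in_lcosets[OF assms], of n]]
    card_chains_from_E_orbit_category[of "(H, H)" n] self_in_lcosets[OF assms]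
  by (simp add: assms coset_stabilizer_self orbit_category_simps)

text \<open>The maps of the chain are equivariant: moving the first point by \<open>g\<close> moves
  all later points by \<open>g\<close> and leaves the maps as they are.\<close>

lemma lift_chain_translate:
  assumes "nondegenerate_chain \<O> H ms" "a \<in> lcosets H" "g \<in> carrier G"
  shows "lift_chain (g <#\<^bsub>G\<^esub> a) ms = map (act_mor E\<O> g) (lift_chain a ms)"
  using assms
proof (induction a ms arbitrary: H rule: lift_chain.induct)
  case (2 a H' \<phi> K ms)
  then have m: "H' = H" "H \<in> \<C>" "K \<in> \<C>" "\<phi> \<in> coset_gmaps G H K"
    and ms: "nondegenerate_chain \<O> K ms"
    by (auto simp: orbit_category_def)
  have \<phi>: "\<phi> (g <#\<^bsub>G\<^esub> a) = g <#\<^bsub>G\<^esub> \<phi> a" "\<phi> a \<in> lcosets K"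
    using coset_gmap_translate[OF m(4)] coset_gmap_closed[OF m(4)] "2.prems" by auto
  have "lift_chain (g <#\<^bsub>G\<^esub> \<phi> a) ms = map (act_mor E\<O> g) (lift_chain (\<phi> a) ms)"
    using "2.IH"[OF ms \<phi>(2)] "2.prems" by blast
  with \<phi> m "2.prems" show ?case
    by (simp add: orbit_category_simps coset_action_eq)
qed simp

section \<open>Decomposition of the simplices into orbits\<close>

lemma finite_gset_lcosets: "H \<in> \<C> \<Longrightarrow> finite_gset G (lcosets H) (coset_action G H)"
  using group_action_coset_action[OF is_group subgroups] finite_lcosets by (simp add: finite_gset_def)

lemma finite_chains_from_orbit_category: "finite (chains_from \<O> n H)" if "H \<in> \<C>"
  using bij_betw_finite[OF bij_betw_lift_chain[OF self_in_lcosets[OF that]]]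
    finite_chains_from[OF finite_mor_E_orbit_category] by blast

text \<open>A chain of the orbit category starting at \<open>H\<close> has one lift for each point
  of G/H, and these lifts form one orbit. \<open>J n\<close> indexes the orbits by the
  chains.\<close>

lemma simplices_gset_iso:
  defines "J \<equiv> \<lambda>n. Sigma \<C> (chains_from \<O> n)"
  shows "gset_iso G (Sigma (J n) (\<lambda>(H, ms). lcosets H))
    (sigma_action (J n) (\<lambda>(H, ms). lcosets H) (\<lambda>(H, ms). coset_action G H))
    (simplices E\<O> n) (simplex_action E\<O> n)"
proof -
  let ?X = "\<lambda>(H, ms). lcosets H" and ?f = "\<lambda>((H, ms), a). ((H, a), lift_chain a ms)"
  have simplices_iff: "((H, a), ns) \<in> simplices E\<O> n \<longleftrightarrow>
      H \<in> \<C> \<and> a \<in> lcosets H \<and> ns \<in> lift_chain a ` chains_from \<O> n H" for H a ns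
    using bij_betw_lift_chain[of a H n] nondegenerate_chain_is_lift_chain[of H a ns]
    by (auto simp: bij_betw_def simplices_def chains_from_def)
  have "bij_betw ?f (Sigma (J n) ?X) (simplices E\<O> n)"
  proof (rule bij_betw_imageI)
    show "inj_on ?f (Sigma (J n) ?X)"
      using inj_lift_chain by (auto intro!: inj_onI dest: injD)
    show "?f ` Sigma (J n) ?X = simplices E\<O> n"
    proof (intro subset_antisym subsetI)
      fix s assume "s \<in> simplices E\<O> n"
      moreover obtain H a ns where s: "s = ((H, a), ns)"
        by (metis surj_pair)
      ultimately obtain ms where ms: "H \<in> \<C>" "a \<in> lcosets H" "ms \<in> chains_from \<O> n H"
          "ns = lift_chain a ms"
        by (auto simp: simplices_iff)
      then show "s \<in> ?f ` Sigma (J n) ?X"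
        by (intro image_eqI[of _ _ "((H, ms), a)"]) (auto simp: s J_def)
    qed (auto simp: J_def simplices_iff)
  qed
  moreover have "?f (sigma_action (J n) ?X (\<lambda>(H, ms). coset_action G H) g z) =
      simplex_action E\<O> n g (?f z)"
    if g: "g \<in> carrier G" and z: "z \<in> Sigma (J n) ?X" for g z
  proof -
    obtain H ms a where z': "z = ((H, ms), a)" "H \<in> \<C>" "ms \<in> chains_from \<O> n H" "a \<in> lcosets H"
      using z by (auto simp: J_def)
    then have "?f z \<in> simplices E\<O> n"
      by (auto simp: simplices_iff)
    moreover have "lift_chain (g <#\<^bsub>G\<^esub> a) ms = map (act_mor E\<O> g) (lift_chain a ms)"
      using z' g by (intro lift_chain_translate) (auto simp: chains_from_def)
    ultimately show ?thesis
      using z z' g by (simp add: sigma_action_def simplex_action_def coset_action_eq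
          E_orbit_category_def mem_E_orbit_category_obj)
  qed
  ultimately show ?thesis
    unfolding gset_iso_def by (intro exI[of _ ?f] conjI ballI)
qed

text \<open>The orbits are collected by their first subgroup \<open>H\<close>; the multiplicity of
  [G/H] is the number of chains from \<open>H\<close>.\<close>

lemma simplex_series_eq:
  "simplex_series G E\<O> n = burnside_coset G (\<Sum>H\<in>\<C>. scale_pm (chain_count n H)
     (Poly_Mapping.single (gset_class G (lcosets H) (coset_action G H)) 1))"
proof -
  let ?J = "Sigma \<C> (chains_from \<O> n)"
  let ?X = "\<lambda>(H, ms). lcosets H" and ?\<psi> = "\<lambda>(H, ms). coset_action G H"
  let ?e = "\<lambda>H. Poly_Mapping.single (gset_class G (lcosets H) (coset_action G H)) (1 :: rat)"
  have finJ: "finite ?J"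
    using finite_collection finite_chains_from_orbit_category by (intro finite_SigmaI)
  have gsets: "finite_gset G (?X j) (?\<psi> j)" if "j \<in> ?J" for j
    using that finite_gset_lcosets by auto
  have "gset_class G (simplices E\<O> n) (simplex_action E\<O> n) =
      gset_class G (Sigma ?J ?X) (sigma_action ?J ?X ?\<psi>)"
    using finite_gset_sigma_action[OF is_group finJ gsets] simplices_gset_iso
    by (intro gset_class_cong[symmetric]) (auto simp: finite_gset_def)
  moreover have "Poly_Mapping.single (gset_class G (Sigma ?J ?X) (sigma_action ?J ?X ?\<psi>)) 1
      - (\<Sum>j\<in>?J. Poly_Mapping.single (gset_class G (?X j) (?\<psi> j)) 1) \<in> burnside_ideal G"
    by (rule single_gset_class_sigma[OF is_group finJ gsets])
  moreover have "(\<Sum>j\<in>?J. Poly_Mapping.single (gset_class G (?X j) (?\<psi> j)) (1 :: rat)) =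
      (\<Sum>H\<in>\<C>. \<Sum>ms\<in>chains_from \<O> n H. ?e H)"
    using finite_collection finite_chains_from_orbit_category
    by (subst sum.Sigma) (auto intro!: sum.cong)
  moreover have "(\<Sum>ms\<in>chains_from \<O> n H. ?e H) = scale_pm (chain_count n H) (?e H)" if "H \<in> \<C>" for H
  proof -
    have "(\<Sum>ms\<in>chains_from \<O> n H. scale_pm 1 (?e H)) =
        scale_pm (\<Sum>ms\<in>chains_from \<O> n H. 1) (?e H)"
      by (rule pm.scale_sum_left[symmetric])
    then show ?thesis
      using card_chains_from_orbit_category[OF that, of n] by simp
  qed
  ultimately show ?thesis
    by (simp add: simplex_series_def burnside_class_def burnside_coset_eq_iff)
qed


section \<open>The generating function of chains\<close>

text \<open>Downward induction along inclusion: the recursion for the coefficients is a linear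
  equation for the series of \<open>H\<close> in terms of those of larger subgroups. It is solved in
  the local ring and evaluated with the dual recursion of \<mu>.\<close>

lemma poly_quotient_value_chain_count:
  assumes "H \<in> \<C>"
  shows "poly_quotient_value (Abs_fps (\<lambda>n. chain_count n H))
    (- of_int (moebius (adjoin_top \<C>) (Some H) None) / of_nat (card (lcosets H)))"
  using assms
proof (induction "card {K \<in> \<C>. H \<subset> K}" arbitrary: H rule: less_induct)
  case less
  let ?m = "\<lambda>K. of_nat (card (lcosets K)) :: rat"
  let ?\<mu> = "\<lambda>K. of_int (moebius (adjoin_top \<C>) (Some K) None) :: rat"
  let ?F = "\<lambda>K. Abs_fps (\<lambda>n. chain_count n K)"
  let ?above = "{K \<in> \<C>. H \<subset> K}"
  have m: "?m K \<noteq> 0" if "K \<in> \<C>" for K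
    using card_lcosets_pos[OF that] by simp
  have above: "{K. K \<in> \<C> \<and> H \<subseteq> K} = insert H ?above"
    using less.prems by auto
  have fin: "finite ?above"
    using finite_collection by simp
  have IH: "poly_quotient_value (?F K) (- ?\<mu> K / ?m K)" if K: "K \<in> ?above" for K
  proof (rule less.hyps)
    show "card {L \<in> \<C>. K \<subset> L} < card ?above"
      using K fin by (intro psubset_card_mono) auto
  qed (use K in auto)
  \<comment> \<open>The term \<open>K = H\<close> of the recursion and the subtracted count are
    moved to the left, giving the factor 1 + (1 - |G : H|) t. The constant 1 on the right is the
    coefficient at 0.\<close>
  have eq: "fps_of_poly [:1, 1 - ?m H:] * ?F H =
      fps_of_poly [:1:] + (\<Sum>K\<in>?above. fps_of_poly [:0, ?m K:] * ?F K)"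
    (is "?l = ?r")
  proof (rule fps_ext)
    fix n show "fps_nth ?l n = fps_nth ?r n"
    proof (cases n)
      case 0
      then show ?thesis
        by (simp add: fps_sum_nth)
    next
      case (Suc k)
      have "fps_nth (fps_of_poly [:a, b:] * f) (Suc k) = a * fps_nth f (Suc k) + b * fps_nth f k"
        for a b :: rat and f
        by (simp add: fps_of_poly_pCons distrib_right mult.assoc)
      then show ?thesis
        using fin by (simp add: Suc fps_sum_nth above algebra_simps)
    qed
  qed
  have "(\<Sum>K | K \<in> \<C> \<and> H \<subseteq> K. ?\<mu> K) = -1"
    unfolding of_int_sum[symmetric] sum_moebius_adjoin_top[OF finite_collection less.prems] by simp
  then have "?\<mu> H + (\<Sum>K\<in>?above. ?\<mu> K) = -1"
    using fin by (simp add: above)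
  \<comment> \<open>At -1 the factor |G : K| t becomes -|G : K|, which cancels both the denominator
    and the sign of the inductive value.\<close>
  moreover have "poly [:0, ?m K:] (-1) * (- ?\<mu> K / ?m K) = ?\<mu> K" if "K \<in> ?above" for K
    using m that by simp
  \<comment> \<open>The right-hand side of \<open>eq\<close> has value 1 plus the sum of \<mu>(K,
    \<infinity>) over the larger K, which is -\<mu>(H, \<infinity>) by the dual recursion.\<close>
  ultimately have "- ?\<mu> H =
      poly [:1:] (-1) + (\<Sum>K\<in>?above. poly [:0, ?m K:] (-1) * (- ?\<mu> K / ?m K))"
    by (simp add: eq_neg_iff_add_eq_0 neg_eq_iff_add_eq_0 algebra_simps)
  moreover have "poly_quotient_value ?r
      (poly [:1:] (-1) + (\<Sum>K\<in>?above. poly [:0, ?m K:] (-1) * (- ?\<mu> K / ?m K)))"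
    by (intro poly_quotient_value_add poly_quotient_value_poly poly_quotient_value_sum
        poly_quotient_value_mult IH)
  ultimately have "poly_quotient_value ?l (- ?\<mu> H)"
    unfolding eq by (simp only:)
  \<comment> \<open>The left factor takes the value 1 - (1 - |G : H|) = |G : H| at -1, which is
    nonzero and is the denominator of the claim.\<close>
  then have "poly_quotient_value (?F H) (- ?\<mu> H / poly [:1, 1 - ?m H:] (-1))"
    by (rule poly_quotient_value_divide) (use m[OF less.prems] in simp)
  then show ?case
    by simp
qed

end


section \<open>The series Lefschetz invariant\<close>

theorem theoremA:
  fixes G :: "('g, 'b) monoid_scheme" and \<C> :: "'g set set"
  assumes "group G" and "finite (carrier G)"
    and "\<And>H. H \<in> \<C> \<Longrightarrow> subgroup H G"
    and "\<And>H g. H \<in> \<C> \<Longrightarrow> g \<in> carrier G \<Longrightarrow> g <#\<^bsub>G\<^esub> H #>\<^bsub>G\<^esub> inv\<^bsub>G\<^esub> g \<in> \<C>"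
  shows "has_series_lefschetz_invariant G (E_orbit_category G \<C>) \<and>
    \<Lambda>\<^sub>\<Sigma> G (E_orbit_category G \<C>) =
      (\<Oplus>\<^bsub>\<Omega> G\<^esub>H\<in>\<C>.
         (- of_int (moebius (adjoin_top \<C>) (Some H) None) / of_nat (card (lcosets\<^bsub>G\<^esub> H)))
           \<odot>\<^bsub>\<Omega> G\<^esub> burnside_class G (lcosets\<^bsub>G\<^esub> H) (coset_action G H))"
proof -
  interpret subgroup_collection G \<C>
    using assms by (simp add: subgroup_collection_def subgroup_collection_axioms_def)
  let ?e = "\<lambda>H. Poly_Mapping.single (gset_class G (lcosets\<^bsub>G\<^esub> H) (coset_action G H)) (1 :: rat)"
  let ?v = "\<lambda>H. - of_int (moebius (adjoin_top \<C>) (Some H) None) / of_nat (card (lcosets\<^bsub>G\<^esub> H)) :: rat"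
  let ?f = "laurent_of_power_series G (simplex_series G E\<O>)"
  have e: "?e H \<in> gset_vectors G" if "H \<in> \<C>" for H
    using finite_gset_lcosets[OF that] by (rule single_gset_class_in_gset_vectors)
  \<comment> \<open>One rational function for each \<open>H\<close>, expanding to the generating
    function of chains and taking the claimed coefficient as its value at -1.\<close>
  have "\<forall>H\<in>\<C>. \<exists>r. r \<in> rational_functions_at_minus_one \<and>
      laurent_of_fract r = fps_to_fls (Abs_fps (\<lambda>n. chain_count n H)) \<and> fract_at_minus_one r = ?v H"
    using poly_quotient_value_fract[OF poly_quotient_value_chain_count] by blast
  from bchoice[OF this] obtain r where r: "\<forall>H\<in>\<C>. r H \<in> rational_functions_at_minus_one \<and>
      laurent_of_fract (r H) = fps_to_fls (Abs_fps (\<lambda>n. chain_count n H)) \<and>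
      fract_at_minus_one (r H) = ?v H"
    by blast
  \<comment> \<open>\<open>represents\<close> takes tensors indexed by an initial segment of the
    naturals, hence an enumeration of \<C>.\<close>
  obtain h where h: "bij_betw h {..<card \<C>} \<C>"
    using ex_bij_betw_nat_finite[OF finite_collection] by (auto simp: atLeast0LessThan)
  then have hC: "h i \<in> \<C>" if "i < card \<C>" for i
    using that by (auto simp: bij_betw_def)
  let ?x = "\<lambda>i. burnside_coset G (?e (h i))"
  have finsum_h: "(\<Oplus>\<^bsub>\<Omega> G\<^esub>i\<in>{..<card \<C>}. c (h i) \<odot>\<^bsub>\<Omega> G\<^esub> ?x i) =
      burnside_coset G (\<Sum>H\<in>\<C>. scale_pm (c H) (?e H))" for c
  proof -
    have "(\<Oplus>\<^bsub>\<Omega> G\<^esub>i\<in>{..<card \<C>}. c (h i) \<odot>\<^bsub>\<Omega> G\<^esub> ?x i) =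
        burnside_coset G (\<Sum>i<card \<C>. scale_pm (c (h i)) (?e (h i)))"
      by (rule finsum_burnside_ring) (use e hC in auto)
    also have "(\<Sum>i<card \<C>. scale_pm (c (h i)) (?e (h i))) = (\<Sum>H\<in>\<C>. scale_pm (c H) (?e H))"
      by (rule sum.reindex_bij_betw[OF h])
    finally show ?thesis .
  qed
  have rep: "represents G ?f (card \<C>) ?x (\<lambda>i. r (h i))"
    unfolding represents_def
  proof (intro conjI allI impI)
    fix i assume "i < card \<C>"
    then show "?x i \<in> carrier (\<Omega> G)" "r (h i) \<in> rational_functions_at_minus_one"
      using e r hC by (auto simp: carrier_burnside_ring)
  next
    fix k
    \<comment> \<open>For negative \<open>k\<close> both sides are zero, since a power series has no
      principal part; otherwise the coefficients are the chain counts.\<close>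
    have "?f k = burnside_coset G (\<Sum>H\<in>\<C>. scale_pm (fls_nth (laurent_of_fract (r H)) k) (?e H))"
    proof (cases "k < 0")
      case True
      then show ?thesis
        using r by (simp add: laurent_of_power_series_def zero_burnside_ring)
    next
      case False
      then show ?thesis
        using r by (simp add: laurent_of_power_series_def simplex_series_eq)
    qed
    then show "?f k = (\<Oplus>\<^bsub>\<Omega> G\<^esub>i\<in>{..<card \<C>}. fls_nth (laurent_of_fract (r (h i))) k \<odot>\<^bsub>\<Omega> G\<^esub> ?x i)"
      by (simp only: finsum_h[of "\<lambda>H. fls_nth (laurent_of_fract (r H)) k"])
  qed
  have "\<Lambda>\<^sub>\<Sigma> G E\<O> =
      (\<Oplus>\<^bsub>\<Omega> G\<^esub>i\<in>{..<card \<C>}. fract_at_minus_one (r (h i)) \<odot>\<^bsub>\<Omega> G\<^esub> ?x i)"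
    unfolding series_lefschetz_invariant_def by (rule value_at_minus_one_eq[OF rep])
  also have "\<dots> = burnside_coset G (\<Sum>H\<in>\<C>. scale_pm (fract_at_minus_one (r H)) (?e H))"
    by (rule finsum_h[of "\<lambda>H. fract_at_minus_one (r H)"])
  also have "\<dots> = burnside_coset G (\<Sum>H\<in>\<C>. scale_pm (?v H) (?e H))"
    using r by simp
  also have "\<dots> = (\<Oplus>\<^bsub>\<Omega> G\<^esub>H\<in>\<C>. ?v H \<odot>\<^bsub>\<Omega> G\<^esub> burnside_class G (lcosets\<^bsub>G\<^esub> H) (coset_action G H))"
    unfolding burnside_class_def
    by (rule finsum_burnside_ring[symmetric]) (use finite_collection e in auto)
  finally show ?thesis
    using rep by (auto simp: has_series_lefschetz_invariant_def)
qed

end
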